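(* Consider the switched DAE $$E_\sigma \dot x = A_\sigma x + B_\sigma u,\qquad y = C_\sigma x + D_\sigma u,$$ with switching signal $\sigma$ and switching times $0=:t_0<t_1<t_2<\cdots$. Assume the system is uniformly interval-detectable, i.e. there exist a strictly increasing sequence of integers $(q_i)_{i=0}^\infty$ with $q_0>0=:q_{-1}$ and constants $\alpha\in(0,1)$, $M\ge 1$ such that, with $p_i:=q_{i-1}$, for every $i\in\mathbb{N}=\{0,1,2,\dots\}$ the system is $[t_{p_i},t_{q_i})$-detectable with a class $\mathcal{KL}$ function $\beta_i$ which additionally satisfies $$\beta_i(r,t_{q_i}-t_{p_i})\le \alpha r\quad\text{and}\quad \beta_i(r,0)\le M r\qquad\text{for all } r>0.$$ Then the switched DAE is detectable (for the given switching signal $\sigma$).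
   Context: **Switched DAE.** $x,u,y$ are the state, input and output, of dimensions $n,\mathtt{u},\mathtt{y}$. The switching signal $\sigma:[0,\infty)\to\mathbb{N}$ is piecewise constant and right-continuous (finitely many switches in each bounded interval), with switching times $0<t_1<t_2<\cdots$ and $t_0:=0$. On $[t_k,t_{k+1})$ the active mode is given by matrices $(E_k,A_k,B_k,C_k,D_k)\in\mathbb{R}^{n\times n}\times\mathbb{R}^{n\times n}\times\mathbb{R}^{n\times \mathtt{u}}\times\mathbb{R}^{\mathtt{y}\times n}\times\mathbb{R}^{\mathtt{y}\times \mathtt{u}}$, $k\in\mathbb{N}$; the $E_k$ need not be invertible. **Piecewise-smooth distributions.** $\mathbb{D}_{\mathrm{pw}\mathcal{C}^\infty}$ is the space of distributions on $\mathbb{R}$ of the form $D=f_{\mathbb{D}}+\sum_{t\in T}D_t$, where $f$ is a piecewise-smooth function, $f_{\mathbb D}$ is the distribution induced by $f$, $T\subseteq\mathbb{R}$ is discrete and $D_t\in\mathrm{span}\{\delta_t,\delta_t',\delta_t'',\dots\}$. One sets $D(t^\pm):=f(t^\pm)$ (one-sided limits), $D[t]:=D_t$ for $t\in T$ and $D[t]:=0$ otherwise. The restriction to an interval $\mathcal{I}$ is $D_{\mathcal I}:=(\mathbb{1}_{\mathcal I}f)_{\mathbb D}+\sum_{t\in T\cap \mathcal I}D_t$. Derivatives are distributional derivatives. **Solutions.** $(x,u,y)$ with all components in $\mathbb{D}_{\mathrm{pw}\mathcal{C}^\infty}$ is a solution on an interval $\mathcal{I}\subseteq[0,\infty)$ if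 the switched DAE restricted to $\mathcal{I}$ holds as an equality of distributions, i.e. for each $k$ and $J=\mathcal{I}\cap[t_k,t_{k+1})$: $(E_k\dot x)_J=(A_kx+B_ku)_J$ and $y_J=(C_kx+D_ku)_J$. If no interval is mentioned, $\mathcal{I}=[0,\infty)$. (The value at the left of the interval, e.g. $x(0^-)$, is not constrained to be consistent.) **Class $\mathcal{KL}$.** $\beta:\mathbb{R}_{\ge0}\times\mathbb{R}_{\ge0}\to\mathbb{R}_{\ge0}$ is of class $\mathcal{KL}$ if 1) for each $t\ge0$, $\beta(\cdot,t)$ is continuous, strictly increasing, with $\beta(0,t)=0$; and 2) for each $r\ge0$, $\beta(r,\cdot)$ is decreasing and converging to zero as $t\to\infty$. **Detectability.** The switched DAE is detectable (for the given $\sigma$) if there is a class $\mathcal{KL}$ function $\beta$ such that for any two solutions $(x_1,u,y)$, $(x_2,u,y)$ (same $u$ and $y$), $|x_1(t^+)-x_2(t^+)|\le\beta(|x_1(0^-)-x_2(0^-)|,t)$ for all $t\ge0$. **Interval-detectability.** The switched DAE is $[t_p,t_q)$-detectable with class $\mathcal{KL}$ function $\beta$ if $\beta(r,t_q-t_p)<r$ for all $r>0$ and for any solution $(x,u=0,y=0)$ on $[t_p,t_q)$ one has $|x(t^+)|\le\beta(|x(t_p^-)|,t-t_p)$ for all $t\in[t_p,t_q)$. $|\cdot|$ is the Euclidean norm.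
   Formalization: The formal theorem additionally assumes that for every i and r>0 the function β_i(r,·) is left-continuous at t_{q_i}-t_{p_i}; without it the claim fails (x'=0, y=0, with β_i dropping at the end of each interval). *)

theory Defs
  imports "HOL-Analysis.Analysis" "HOL-Library.Function_Algebras"
begin

section \<open>Distributions on the real line\<close>

definition smooth :: "(real \<Rightarrow> real) \<Rightarrow> bool" where
  "smooth f \<longleftrightarrow> (\<forall>k. (deriv ^^ k) f differentiable_on UNIV)"

lemma deriv_zero_fun: "deriv (\<lambda>_. 0) = (\<lambda>_. 0 :: real)"
  by (rule ext) (rule DERIV_imp_deriv, rule DERIV_const)

typedef test_fun = "{\<phi>. smooth \<phi> \<and> compact (closure {x. \<phi> x \<noteq> 0})}"
  morphisms apply_test Abs_test_fun
proof
  have "(deriv ^^ k) (\<lambda>_. 0) = (\<lambda>_. 0 :: real)" for k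
    by (induction k) (simp_all add: deriv_zero_fun)
  then show "(\<lambda>_. 0) \<in> {\<phi>. smooth \<phi> \<and> compact (closure {x. \<phi> x \<noteq> 0})}"
    by (simp add: smooth_def)
qed

setup_lifting type_definition_test_fun

lift_definition deriv_test :: "test_fun \<Rightarrow> test_fun" is deriv
proof -
  fix \<phi> :: "real \<Rightarrow> real"
  assume \<phi>: "smooth \<phi> \<and> compact (closure {x. \<phi> x \<noteq> 0})"
  have "smooth (deriv \<phi>)"
    unfolding smooth_def
  proof
    fix k
    have "(deriv ^^ Suc k) \<phi> differentiable_on UNIV"
      using \<phi> unfolding smooth_def by blast
    then show "(deriv ^^ k) (deriv \<phi>) differentiable_on UNIV"
      by (simp only: funpow_Suc_right comp_apply)
  qed
  moreover have "{x. deriv \<phi> x \<noteq> 0} \<subseteq> closure {x. \<phi> x \<noteq> 0}"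
  proof (rule subsetI, rule ccontr)
    fix x assume x: "x \<in> {x. deriv \<phi> x \<noteq> 0}" "x \<notin> closure {x. \<phi> x \<noteq> 0}"
    have "eventually (\<lambda>y. y \<in> - closure {x. \<phi> x \<noteq> 0}) (nhds x)"
      using x by (intro eventually_nhds_in_open) auto
    then have "eventually (\<lambda>y. \<phi> y = 0) (nhds x)"
      by (rule eventually_mono) (simp, metis (mono_tags) closure_subset mem_Collect_eq subsetD)
    then have "deriv \<phi> x = deriv (\<lambda>_. 0) x"
      by (rule deriv_cong_ev) simp
    then have "deriv \<phi> x = 0"
      by (simp only: deriv_zero_fun)
    with x(1) show False by blast
  qed
  then have "closure {x. deriv \<phi> x \<noteq> 0} \<subseteq> closure {x. \<phi> x \<noteq> 0}"
    by (rule closure_minimal) simp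
  then have "closure {x. deriv \<phi> x \<noteq> 0} = closure {x. \<phi> x \<noteq> 0} \<inter> closure {x. deriv \<phi> x \<noteq> 0}"
    by blast
  then have "compact (closure {x. deriv \<phi> x \<noteq> 0})"
    using \<phi> compact_Int_closed closed_closure by metis
  ultimately show "smooth (deriv \<phi>) \<and> compact (closure {x. deriv \<phi> x \<noteq> 0})"
    by blast
qed

text \<open>
  Vector space operations on functionals are pointwise. Continuity is not built into the type:
  the functionals singled out by \<open>pw_smooth_dist\<close> below are automatically linear and continuous.
\<close>

type_synonym dist = "test_fun \<Rightarrow> real"

definition dist_of_fun :: "(real \<Rightarrow> real) \<Rightarrow> dist" where
  "dist_of_fun f = (\<lambda>\<phi>. LINT x|lborel. f x * apply_test \<phi> x)"

definition ddt :: "dist \<Rightarrow> dist" where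
  "ddt D = (\<lambda>\<phi>. - D (deriv_test \<phi>))"

definition dirac :: "real \<Rightarrow> dist" where
  "dirac t = (\<lambda>\<phi>. apply_test \<phi> t)"

definition dirac_span :: "real \<Rightarrow> dist set" where
  "dirac_span t = {D. \<exists>m c. D = (\<lambda>\<phi>. \<Sum>k<m. c k * (ddt ^^ k) (dirac t) \<phi>)}"


section \<open>Piecewise-smooth distributions\<close>

text \<open>
  Pieces live on half-open intervals, so a piecewise-smooth function is right-continuous; this
  makes the function part of a piecewise-smooth distribution unique. Finitely many breakpoints
  are covered as well, since a breakpoint need not be a discontinuity.
\<close>

definition piecewise_smooth :: "(real \<Rightarrow> real) \<Rightarrow> bool" where
  "piecewise_smooth f \<longleftrightarrow>
     (\<exists>(s :: int \<Rightarrow> real) g. strict_mono s \<and> filterlim s at_top at_top \<and> filterlim s at_bot at_bot \<and>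
        (\<forall>i. smooth (g i) \<and> (\<forall>t\<in>{s i..<s (i + 1)}. f t = g i t)))"

definition locally_finite :: "real set \<Rightarrow> bool" where
  "locally_finite T \<longleftrightarrow> (\<forall>a b. finite (T \<inter> {a..b}))"

text \<open>
  In \<open>pw_decomp D f P\<close>, \<open>P t\<close> is the impulsive part \<open>D[t]\<close>, and \<open>T\<close> is the set of times at which
  it is nonzero. On each test function only finitely many summands are nonzero.
\<close>

definition pw_decomp :: "dist \<Rightarrow> (real \<Rightarrow> real) \<Rightarrow> (real \<Rightarrow> dist) \<Rightarrow> bool" where
  "pw_decomp D f P \<longleftrightarrow>
     piecewise_smooth f \<and> locally_finite {t. P t \<noteq> 0} \<and> (\<forall>t. P t \<in> dirac_span t) \<and>
     D = dist_of_fun f + (\<lambda>\<phi>. \<Sum>\<^sub>\<infinity>t\<in>UNIV. P t \<phi>)"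

definition pw_smooth_dist :: "dist set" where
  "pw_smooth_dist = {D. \<exists>f P. pw_decomp D f P}"

definition fun_part :: "dist \<Rightarrow> real \<Rightarrow> real" where
  "fun_part D = (THE f. \<exists>P. pw_decomp D f P)"

definition impulse :: "dist \<Rightarrow> real \<Rightarrow> dist" where
  "impulse D = (THE P. \<exists>f. pw_decomp D f P)"

definition restrict_dist :: "real set \<Rightarrow> dist \<Rightarrow> dist" where
  "restrict_dist J D =
     dist_of_fun (\<lambda>t. indicator J t * fun_part D t) + (\<lambda>\<phi>. \<Sum>\<^sub>\<infinity>t\<in>J. impulse D t \<phi>)"

definition right_val :: "dist ^ 'n \<Rightarrow> real \<Rightarrow> real ^ 'n" where
  "right_val x t = (\<chi> i. Lim (at_right t) (fun_part (x $ i)))"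

definition left_val :: "dist ^ 'n \<Rightarrow> real \<Rightarrow> real ^ 'n" where
  "left_val x t = (\<chi> i. Lim (at_left t) (fun_part (x $ i)))"

definition ddt_vec :: "dist ^ 'n \<Rightarrow> dist ^ 'n" where
  "ddt_vec x = (\<chi> i. ddt (x $ i))"

definition restrict_vec :: "real set \<Rightarrow> dist ^ 'n \<Rightarrow> dist ^ 'n" where
  "restrict_vec J x = (\<chi> i. restrict_dist J (x $ i))"

definition mat_dist :: "real ^ 'n ^ 'm \<Rightarrow> dist ^ 'n \<Rightarrow> dist ^ 'm" where
  "mat_dist Q x = (\<chi> i. (\<lambda>\<phi>. \<Sum>j\<in>UNIV. Q $ i $ j * (x $ j) \<phi>))"


section \<open>Switched differential-algebraic equations\<close>

text \<open>
  \<open>\<tau> k\<close> is the \<open>k\<close>-th switching time. On \<open>{\<tau> k..<\<tau> (Suc k)}\<close> the active mode is \<open>\<sigma> (\<tau> k)\<close>, which is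
  simply \<open>k\<close> when modes are numbered by order of activation.
\<close>

definition switching_signal :: "(real \<Rightarrow> nat) \<Rightarrow> (nat \<Rightarrow> real) \<Rightarrow> bool" where
  "switching_signal \<sigma> \<tau> \<longleftrightarrow>
     \<tau> 0 = 0 \<and> strict_mono \<tau> \<and> (\<forall>b. finite {k. \<tau> k \<le> b}) \<and>
     (\<forall>k. (\<forall>t\<in>{\<tau> k..<\<tau> (Suc k)}. \<sigma> t = \<sigma> (\<tau> k)) \<and> \<sigma> (\<tau> (Suc k)) \<noteq> \<sigma> (\<tau> k))"

record ('n :: finite, 'u :: finite, 'y :: finite) switched_dae =
  Emat :: "nat \<Rightarrow> real ^ 'n ^ 'n"
  Amat :: "nat \<Rightarrow> real ^ 'n ^ 'n"
  Bmat :: "nat \<Rightarrow> real ^ 'u ^ 'n"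
  Cmat :: "nat \<Rightarrow> real ^ 'n ^ 'y"
  Dmat :: "nat \<Rightarrow> real ^ 'u ^ 'y"

definition is_solution ::
  "('n :: finite, 'u :: finite, 'y :: finite) switched_dae \<Rightarrow> (real \<Rightarrow> nat) \<Rightarrow> (nat \<Rightarrow> real) \<Rightarrow>
    real set \<Rightarrow> dist ^ 'n \<Rightarrow> dist ^ 'u \<Rightarrow> dist ^ 'y \<Rightarrow> bool" where
  "is_solution S \<sigma> \<tau> I x u y \<longleftrightarrow>
     (\<forall>i. x $ i \<in> pw_smooth_dist) \<and> (\<forall>i. u $ i \<in> pw_smooth_dist) \<and> (\<forall>i. y $ i \<in> pw_smooth_dist) \<and>
     (\<forall>k. let J = I \<inter> {\<tau> k..<\<tau> (Suc k)}; m = \<sigma> (\<tau> k) in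
        restrict_vec J (mat_dist (Emat S m) (ddt_vec x))
          = restrict_vec J (mat_dist (Amat S m) x + mat_dist (Bmat S m) u) \<and>
        restrict_vec J y = restrict_vec J (mat_dist (Cmat S m) x + mat_dist (Dmat S m) u))"


section \<open>Detectability\<close>

text \<open>
  Decreasing means nonincreasing, because of \<open>\<beta> 0 t = 0\<close>. No continuity in the second argument is
  required. Consequently a bound on \<open>\<beta> r d\<close> says nothing about solutions on an interval of length
  \<open>d\<close> unless \<open>\<beta> r\<close> is left-continuous at \<open>d\<close>: on intervals of length 1 the scalar mode \<open>x' = 0\<close>,
  \<open>y = 0\<close> admits \<open>\<beta> r t = r\<close> for \<open>t < 1\<close> and \<open>\<beta> r t = r * exp (1 - t) / 2\<close> for \<open>t \<ge> 1\<close>. This is why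
  left-continuity at the end of the interval appears as a separate assumption where it is needed.
\<close>

definition class_KL :: "(real \<Rightarrow> real \<Rightarrow> real) \<Rightarrow> bool" where
  "class_KL \<beta> \<longleftrightarrow>
     (\<forall>r\<ge>0. \<forall>t\<ge>0. \<beta> r t \<ge> 0) \<and>
     (\<forall>t\<ge>0. continuous_on {0..} (\<lambda>r. \<beta> r t) \<and> strict_mono_on {0..} (\<lambda>r. \<beta> r t) \<and> \<beta> 0 t = 0) \<and>
     (\<forall>r\<ge>0. antimono_on {0..} (\<beta> r) \<and> (\<beta> r \<longlongrightarrow> 0) at_top)"

definition detectable ::
  "('n :: finite, 'u :: finite, 'y :: finite) switched_dae \<Rightarrow> (real \<Rightarrow> nat) \<Rightarrow> (nat \<Rightarrow> real) \<Rightarrow> bool" where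
  "detectable S \<sigma> \<tau> \<longleftrightarrow>
     (\<exists>\<beta>. class_KL \<beta> \<and>
        (\<forall>x1 x2 u y. is_solution S \<sigma> \<tau> {0..} x1 u y \<and> is_solution S \<sigma> \<tau> {0..} x2 u y \<longrightarrow>
           (\<forall>t\<ge>0. norm (right_val x1 t - right_val x2 t) \<le> \<beta> (norm (left_val x1 0 - left_val x2 0)) t)))"

definition interval_detectable ::
  "('n :: finite, 'u :: finite, 'y :: finite) switched_dae \<Rightarrow> (real \<Rightarrow> nat) \<Rightarrow> (nat \<Rightarrow> real) \<Rightarrow>
    nat \<Rightarrow> nat \<Rightarrow> (real \<Rightarrow> real \<Rightarrow> real) \<Rightarrow> bool" where
  "interval_detectable S \<sigma> \<tau> p q \<beta> \<longleftrightarrow>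
     class_KL \<beta> \<and> (\<forall>r>0. \<beta> r (\<tau> q - \<tau> p) < r) \<and>
     (\<forall>x. is_solution S \<sigma> \<tau> {\<tau> p..<\<tau> q} x 0 0 \<longrightarrow>
        (\<forall>t\<in>{\<tau> p..<\<tau> q}. norm (right_val x t) \<le> \<beta> (norm (left_val x (\<tau> p))) (t - \<tau> p)))"

end

theory Submission
  imports Defs "HOL-Computational_Algebra.Polynomial"
begin

text \<open>
  The difference \<open>x\<close> of two solutions with equal input and output solves the switched DAE with zero
  input and output. Along the block boundaries \<open>t\<^sub>p\<close>, the norms \<open>|x(t\<^sub>p\<^sup>-)|\<close> shrink by the factor
  \<open>\<alpha>\<close> per block: the interval estimate holds for the right limits at all times before the end of the
  block, and left-continuity of \<open>\<beta>\<^sub>i(r, _)\<close> there carries it over to the left limit at the end. Inside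
  a block \<open>|x(t\<^sup>+)|\<close> exceeds the value at its start by at most the factor \<open>M\<close>. So
  \<open>M r \<alpha>\<^sup>N\<close> is a class KL bound, where \<open>N\<close> is the index of the block containing \<open>t\<close>.

  The analytic work lies in the linearity of restriction. Function part and impulses are
  definite descriptions, so linearity requires that the decomposition is unique (tested with cutoff
  functions) and that piecewise-smooth distributions are closed under differentiation
  (integration by parts, with jumps producing Dirac impulses).
\<close>

section \<open>Smooth functions and cutoffs\<close>

text \<open>Coinduction: a set of differentiable functions that is closed under \<open>deriv\<close>
  contains every iterated derivative of its members. It suits families whose derivatives have a
  common closed form, such as \<open>exp_recip_poly\<close>.\<close>

lemma smooth_coinduct:
  assumes "f \<in> X" and "\<And>f. f \<in> X \<Longrightarrow> f differentiable_on UNIV \<and> deriv f \<in> X"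
  shows "smooth f"
proof -
  have "(deriv ^^ k) f \<in> X" for k
    by (induction k) (use assms in auto)
  then show ?thesis
    using assms(2) by (auto simp: smooth_def)
qed

lemma smooth_has_deriv:
  assumes "smooth f"
  shows "(f has_real_derivative deriv f x) (at x)"
proof -
  have "(deriv ^^ 0) f differentiable_on UNIV"
    using assms unfolding smooth_def by blast
  then have "f differentiable at x"
    by (simp add: differentiable_on_def)
  then show ?thesis
    by (simp add: DERIV_deriv_iff_real_differentiable)
qed

lemma smooth_deriv: "smooth f \<Longrightarrow> smooth (deriv f)"
  unfolding smooth_def by (metis funpow_Suc_right comp_apply)

lemma smooth_continuous: "smooth f \<Longrightarrow> continuous_on A f"
  by (meson DERIV_isCont continuous_at_imp_continuous_on smooth_has_deriv)

lemma smooth_tendsto: "smooth f \<Longrightarrow> (f \<longlongrightarrow> f x) (at x within A)"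
  using DERIV_isCont[OF smooth_has_deriv] isCont_def tendsto_within_subset by blast

section \<open>Smoothness by order: sums, products and inverses\<close>

primrec diff_times :: "nat \<Rightarrow> (real \<Rightarrow> real) \<Rightarrow> bool" where
  "diff_times 0 f \<longleftrightarrow> (\<forall>x. (f has_real_derivative deriv f x) (at x))"
| "diff_times (Suc k) f \<longleftrightarrow> (\<forall>x. (f has_real_derivative deriv f x) (at x)) \<and> diff_times k (deriv f)"

lemma diff_times_Suc_imp: "diff_times (Suc k) f \<Longrightarrow> diff_times k f"
  by (induction k arbitrary: f) auto

text \<open>\<open>diff_times k f\<close> means that \<open>f\<close> is differentiable
  \<open>k + 1\<close> times, with the recursion running through \<open>deriv f\<close>. This
  permits inductions on the order for general \<open>f\<close> and \<open>g\<close>, as suits the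
  product rule, where \<open>smooth\<close> speaks of all orders at once.\<close>

lemma smooth_iff_diff_times: "smooth f \<longleftrightarrow> (\<forall>k. diff_times k f)"
proof
  assume "smooth f"
  have "diff_times k f" for k
    using \<open>smooth f\<close> by (induction k arbitrary: f) (auto simp: smooth_has_deriv smooth_deriv)
  then show "\<forall>k. diff_times k f" ..
next
  assume *: "\<forall>k. diff_times k f"
  show "smooth f"
  proof (rule smooth_coinduct)
    show "f \<in> {f. \<forall>k. diff_times k f}" using * by simp
  next
    fix f assume f: "f \<in> {f. \<forall>k. diff_times k f}"
    then have "diff_times (Suc k) f" for k by blast
    then show "f differentiable_on UNIV \<and> deriv f \<in> {f. \<forall>k. diff_times k f}"
      by (simp add: differentiable_on_def)
        (meson differentiable_at_withinI real_differentiable_def)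
  qed
qed

lemma diff_times_const: "diff_times k (\<lambda>_. c)"
  by (induction k arbitrary: c) auto

lemma diff_times_add:
  "diff_times k f \<Longrightarrow> diff_times k g \<Longrightarrow> diff_times k (\<lambda>x. f x + g x)"
proof (induction k arbitrary: f g)
  case 0
  then show ?case
    by (auto simp: DERIV_deriv_iff_real_differentiable)
next
  case (Suc k)
  have "((\<lambda>x. f x + g x) has_real_derivative deriv f x + deriv g x) (at x)" for x
    using Suc.prems by (auto intro: derivative_intros)
  moreover from this have "deriv (\<lambda>x. f x + g x) = (\<lambda>x. deriv f x + deriv g x)"
    using DERIV_imp_deriv by blast
  ultimately show ?case
    using Suc by auto
qed

lemma diff_times_mult:
  "diff_times k f \<Longrightarrow> diff_times k g \<Longrightarrow> diff_times k (\<lambda>x. f x * g x)"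
proof (induction k arbitrary: f g)
  case 0
  then show ?case
    by (auto simp: DERIV_deriv_iff_real_differentiable)
next
  case (Suc k)
  have "((\<lambda>x. f x * g x) has_real_derivative deriv f x * g x + f x * deriv g x) (at x)" for x
    using Suc.prems by (auto intro!: derivative_eq_intros)
  moreover from this have "deriv (\<lambda>x. f x * g x) = (\<lambda>x. deriv f x * g x + f x * deriv g x)"
    using DERIV_imp_deriv by blast
  moreover have "diff_times k f" "diff_times k g"
    using Suc.prems by (auto intro: diff_times_Suc_imp)
  ultimately show ?case
    using Suc by (auto intro!: diff_times_add)
qed

lemma diff_times_inverse:
  assumes "\<And>x. f x \<noteq> 0"
  shows "diff_times k f \<Longrightarrow> diff_times k (\<lambda>x. inverse (f x))"
proof (induction k)
  case 0
  then show ?case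
    using assms by (auto simp: DERIV_deriv_iff_real_differentiable)
next
  case (Suc k)
  \<comment> \<open>The square is written as a product so that \<open>diff_times_mult\<close>
    applies; the induction hypothesis supplies the factor \<open>inverse (f x)\<close> to order
    \<open>k\<close>.\<close>
  have "((\<lambda>x. inverse (f x)) has_real_derivative - 1 * (deriv f x * (inverse (f x) * inverse (f x)))) (at x)" for x
    using Suc.prems assms by (auto intro!: derivative_eq_intros simp: power2_eq_square)
  moreover from this have
    "deriv (\<lambda>x. inverse (f x)) = (\<lambda>x. - 1 * (deriv f x * (inverse (f x) * inverse (f x))))"
    using DERIV_imp_deriv by blast
  moreover have "diff_times k f"
    using Suc.prems by (auto intro: diff_times_Suc_imp)
  ultimately show ?case
    using Suc by (auto intro!: diff_times_mult[of _ "\<lambda>_. - 1", simplified] diff_times_mult diff_times_const[of _ "-1"])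
qed

lemma smooth_const: "smooth (\<lambda>_. c)"
  and smooth_add: "smooth f \<Longrightarrow> smooth g \<Longrightarrow> smooth (\<lambda>x. f x + g x)"
  and smooth_mult: "smooth f \<Longrightarrow> smooth g \<Longrightarrow> smooth (\<lambda>x. f x * g x)"
  and smooth_inverse: "(\<And>x. f x \<noteq> 0) \<Longrightarrow> smooth f \<Longrightarrow> smooth (\<lambda>x. inverse (f x))"
  by (simp_all add: smooth_iff_diff_times diff_times_const diff_times_add diff_times_mult diff_times_inverse)

lemma smooth_affine:
  assumes "smooth f"
  shows "smooth (\<lambda>x. f (c * x + d))"
proof (rule smooth_coinduct)
  \<comment> \<open>The factor \<open>e\<close> is carried along because every differentiation
    multiplies by \<open>c\<close>.\<close>
  let ?X = "{\<lambda>x. e * f (c * x + d) | e f. smooth f}"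
  show "(\<lambda>x. f (c * x + d)) \<in> ?X"
    using assms by (auto intro!: exI[of _ 1] exI[of _ f])
  fix g assume "g \<in> ?X"
  then obtain e f where g: "g = (\<lambda>x. e * f (c * x + d))" and f: "smooth f" by auto
  have "(f has_real_derivative deriv f (c * x + d)) (at (c * x + d))" for x
    by (rule smooth_has_deriv) fact
  then have "((\<lambda>x. f (c * x + d)) has_real_derivative deriv f (c * x + d) * c) (at x)" for x
    by (rule DERIV_chain2) (auto intro!: derivative_eq_intros)
  then have der: "(g has_real_derivative (e * c) * deriv f (c * x + d)) (at x)" for x
    unfolding g by (auto intro!: derivative_eq_intros)
  then have "deriv g = (\<lambda>x. (e * c) * deriv f (c * x + d))"
    using DERIV_imp_deriv by blast
  moreover have "g differentiable_on UNIV"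
    using der by (meson differentiable_on_def differentiable_at_withinI real_differentiable_def)
  ultimately show "g differentiable_on UNIV \<and> deriv g \<in> ?X"
    using smooth_deriv[OF f] by blast
qed

section \<open>The flat function exp(-1/x) and smooth steps\<close>

definition exp_recip_poly :: "real poly \<Rightarrow> real \<Rightarrow> real" where
  "exp_recip_poly P x = (if x > 0 then poly P (1 / x) * exp (- (1 / x)) else 0)"

lemma poly_times_exp_tendsto_0: "((\<lambda>y. poly P y * exp (- y)) \<longlongrightarrow> 0) (at_top :: real filter)"
proof -
  have "((\<lambda>y. \<Sum>i\<le>degree P. coeff P i * (y ^ i / exp y)) \<longlongrightarrow> (\<Sum>i\<le>degree P. coeff P i * 0)) (at_top :: real filter)"
    by (intro tendsto_sum tendsto_mult tendsto_const tendsto_power_div_exp_0)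
  then show ?thesis
    by (simp add: poly_altdef sum_distrib_right exp_minus divide_inverse mult.assoc)
qed

text \<open>With \<open>y = 1 / x\<close>, the derivative of P(y) exp(-y) in \<open>y\<close> is (P'
  - P)(y) exp(-y), and the chain rule contributes \<open>- y^2\<close>. Thus the functions
  \<open>exp_recip_poly P\<close> form a family closed under differentiation.\<close>

lemma exp_recip_poly_has_deriv:
  "(exp_recip_poly P has_real_derivative exp_recip_poly (monom 1 2 * (P - pderiv P)) x) (at x)"
proof (cases x "0 :: real" rule: linorder_cases)
  case greater
  have "((\<lambda>x. poly P (1 / x) * exp (- (1 / x))) has_real_derivative
      poly (monom 1 2 * (P - pderiv P)) (1 / x) * exp (- (1 / x))) (at x)"
    using greater
    by (auto intro!: derivative_eq_intros poly_DERIV[THEN DERIV_chain2]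
        simp: poly_monom field_simps power2_eq_square)
  moreover have "eventually (\<lambda>y. y \<in> {0<..}) (nhds x)"
    using greater by (intro eventually_nhds_in_open) auto
  then have "eventually (\<lambda>y. poly P (1 / y) * exp (- (1 / y)) = exp_recip_poly P y) (nhds x)"
    by eventually_elim (simp add: exp_recip_poly_def)
  ultimately show ?thesis
    using greater by (subst (asm) DERIV_cong_ev[OF refl _ refl]) (auto simp: exp_recip_poly_def)
next
  case less
  have "eventually (\<lambda>y. y \<in> {..<0}) (nhds x)"
    using less by (intro eventually_nhds_in_open) auto
  then have "eventually (\<lambda>y. 0 = exp_recip_poly P y) (nhds x)"
    by eventually_elim (simp add: exp_recip_poly_def)
  then have "((\<lambda>_. 0) has_real_derivative 0) (at x) \<longleftrightarrow> (exp_recip_poly P has_real_derivative 0) (at x)"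
    by (intro DERIV_cong_ev) auto
  then show ?thesis
    using less by (simp add: exp_recip_poly_def)
next
  case equal
  \<comment> \<open>The difference quotient at 0 from the right has the same form, with polynomial X
    P, and the exponential dominates as \<open>1 / h\<close> tends to infinity.\<close>
  have "((\<lambda>h. poly (monom 1 1 * P) (1 / h) * exp (- (1 / h))) \<longlongrightarrow> 0) (at_right 0)"
    using filterlim_compose[OF poly_times_exp_tendsto_0[of "monom 1 1 * P"] filterlim_inverse_at_top_right]
    by (simp add: inverse_eq_divide)
  then have "((\<lambda>h. exp_recip_poly P h / h) \<longlongrightarrow> 0) (at_right 0)"
    by (rule Lim_transform_eventually)
      (auto simp: eventually_at_filter exp_recip_poly_def poly_monom)
  moreover have "((\<lambda>h. exp_recip_poly P h / h) \<longlongrightarrow> 0) (at_left 0)"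
    by (rule Lim_transform_eventually[OF tendsto_const])
      (auto simp: eventually_at_filter exp_recip_poly_def)
  ultimately have "((\<lambda>h. exp_recip_poly P h / h) \<longlongrightarrow> 0) (at 0)"
    by (simp add: filterlim_at_split)
  then show ?thesis
    using equal by (simp add: DERIV_def exp_recip_poly_def)
qed

lemma smooth_exp_recip_poly: "smooth (exp_recip_poly P)"
proof (rule smooth_coinduct)
  show "exp_recip_poly P \<in> range exp_recip_poly" by simp
  fix f assume "f \<in> range exp_recip_poly"
  then obtain P where f: "f = exp_recip_poly P" by auto
  have "deriv f = exp_recip_poly (monom 1 2 * (P - pderiv P))"
    unfolding f using exp_recip_poly_has_deriv DERIV_imp_deriv by blast
  moreover have "f differentiable_on UNIV"
    unfolding f using exp_recip_poly_has_deriv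
    by (meson differentiable_on_def differentiable_at_withinI real_differentiable_def)
  ultimately show "f differentiable_on UNIV \<and> deriv f \<in> range exp_recip_poly" by blast
qed

text \<open>With h(x) = exp(-1/x) for positive \<open>x\<close> and 0 elsewhere, the step is h(x -
  a) / (h(x - a) + h(b - x)). Since \<open>a < b\<close>, one of the two summands is positive at
  every point, so the denominator never vanishes.\<close>

lemma smooth_step_exists:
  assumes "a < b"
  shows "\<exists>f. smooth f \<and> (\<forall>x\<le>a. f x = 0) \<and> (\<forall>x>a. f x > 0) \<and> (\<forall>x\<ge>b. f x = 1)"
proof -
  let ?h = "exp_recip_poly 1"
  have h: "?h x = 0 \<longleftrightarrow> x \<le> 0" "?h x > 0 \<longleftrightarrow> x > 0" "?h x \<ge> 0" for x
    by (auto simp: exp_recip_poly_def)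
  have shift: "smooth (\<lambda>x. ?h (x - a))" "smooth (\<lambda>x. ?h (b - x))"
    using smooth_affine[OF smooth_exp_recip_poly, of 1 1 "-a"]
      smooth_affine[OF smooth_exp_recip_poly, of 1 "-1" b] by simp_all
  have pos: "?h (x - a) + ?h (b - x) > 0" for x
  proof (cases "x > a")
    case True
    then show ?thesis using h(2)[of "x - a"] h(3)[of "b - x"] by linarith
  next
    case False
    then show ?thesis using assms h(2)[of "b - x"] h(3)[of "x - a"] by linarith
  qed
  have "smooth (\<lambda>x. ?h (x - a) * inverse (?h (x - a) + ?h (b - x)))"
    using pos shift by (intro smooth_mult smooth_inverse smooth_add) (auto simp: less_le)
  moreover have "?h (x - a) * inverse (?h (x - a) + ?h (b - x)) > 0" if "x > a" for x
    using pos[of x] h(2)[of "x - a"] that by simp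
  moreover have "?h (x - a) * inverse (?h (x - a) + ?h (b - x)) = 1" if "x \<ge> b" for x
    using assms h(2)[of "x - a"] h(1)[of "b - x"] that by simp
  ultimately show ?thesis
    using h(1) by (intro exI[of _ "\<lambda>x. ?h (x - a) * inverse (?h (x - a) + ?h (b - x))"]) auto
qed

section \<open>Test functions and their supports\<close>

lemma smooth_apply_test: "smooth (apply_test \<phi>)"
  using apply_test by blast

lemma test_fun_exists:
  assumes "smooth f" "\<And>x. x \<notin> {a..b} \<Longrightarrow> f x = 0"
  obtains \<phi> where "apply_test \<phi> = f"
proof -
  have "closure {x. f x \<noteq> 0} \<subseteq> {a..b}"
    using assms(2) by (intro closure_minimal subsetI) (blast, simp)
  then have "compact (closure {x. f x \<noteq> 0})"
    by (meson bounded_closed_interval bounded_subset closed_closure compact_eq_bounded_closed)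
  then show ?thesis
    using assms(1) that[of "Abs_test_fun f"] by (simp add: Abs_test_fun_inverse)
qed

text \<open>Product of a step rising on \<open>[a, b]\<close> and a reflected step falling on
  \<open>[c, d]\<close>. Positivity on the whole open interval serves to detect a nonzero function
  part, the plateau to isolate a single impulse.\<close>

lemma cutoff_exists:
  assumes "a < b" "b \<le> c" "c < d"
  obtains \<psi> where "\<And>x. x \<notin> {a<..<d} \<Longrightarrow> apply_test \<psi> x = 0"
    "\<And>x. x \<in> {a<..<d} \<Longrightarrow> apply_test \<psi> x > 0" "\<And>x. x \<in> {b..c} \<Longrightarrow> apply_test \<psi> x = 1"
proof -
  obtain f where f: "smooth f" "\<And>x. x \<le> a \<Longrightarrow> f x = 0" "\<And>x. x > a \<Longrightarrow> f x > 0" "\<And>x. x \<ge> b \<Longrightarrow> f x = 1"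
    using smooth_step_exists[OF assms(1)] by blast
  obtain g where g: "smooth g" "\<And>x. x \<le> -d \<Longrightarrow> g x = 0" "\<And>x. x > -d \<Longrightarrow> g x > 0" "\<And>x. x \<ge> -c \<Longrightarrow> g x = 1"
    using smooth_step_exists[of "-d" "-c"] assms by auto
  have "smooth (\<lambda>x. f x * g (- x))"
    using smooth_mult[OF f(1) smooth_affine[OF g(1), of "-1" 0]] by simp
  moreover have "f x * g (- x) = 0" if "x \<notin> {a..d}" for x
    using that f(2)[of x] g(2)[of "-x"] by auto
  ultimately obtain \<psi> where "apply_test \<psi> = (\<lambda>x. f x * g (- x))"
    by (rule test_fun_exists)
  then show ?thesis
    using f g assms by (intro that[of \<psi>]) force+
qed

lemma test_fun_support:
  obtains R where "R > 0" "\<And>x. \<bar>x\<bar> \<ge> R \<Longrightarrow> apply_test \<phi> x = 0"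
proof -
  have "bounded (closure {x. apply_test \<phi> x \<noteq> 0})"
    using apply_test[of \<phi>] by (auto intro: compact_imp_bounded)
  then have "bounded {x. apply_test \<phi> x \<noteq> 0}"
    by (rule bounded_subset[OF _ closure_subset])
  then obtain B where "\<And>x. apply_test \<phi> x \<noteq> 0 \<Longrightarrow> \<bar>x\<bar> \<le> B"
    by (auto simp: bounded_iff)
  then show ?thesis
    by (intro that[of "\<bar>B\<bar> + 1"]) force+
qed

section \<open>Piecewise-smooth functions\<close>

lemma locally_finite_subset: "locally_finite T \<Longrightarrow> S \<subseteq> T \<Longrightarrow> locally_finite S"
  unfolding locally_finite_def by (meson Int_mono finite_subset order_refl)

lemma locally_finite_Un: "locally_finite S \<Longrightarrow> locally_finite T \<Longrightarrow> locally_finite (S \<union> T)"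
  by (simp add: locally_finite_def Int_Un_distrib2)

lemma locally_finite_isolated:
  assumes "locally_finite T"
  obtains d where "d > 0" "{x - d..x + d} \<inter> T \<subseteq> {x}"
proof -
  have "finite (T \<inter> {x - 1..x + 1})"
    using assms by (simp add: locally_finite_def)
  then obtain d where d: "d > 0" "\<And>y. y \<in> T \<inter> {x - 1..x + 1} \<Longrightarrow> y \<noteq> x \<Longrightarrow> d \<le> dist x y"
    using finite_set_avoid[of "T \<inter> {x - 1..x + 1}" x] by metis
  have "y = x" if "y \<in> {x - min (d / 2) 1..x + min (d / 2) 1} \<inter> T" for y
  proof (rule ccontr)
    assume "y \<noteq> x"
    moreover have "y \<in> T \<inter> {x - 1..x + 1}"
      using that by (auto simp: min_def split: if_splits)
    ultimately have "d \<le> dist x y" using d by blast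
    then show False
      using that d(1) by (auto simp: dist_real_def min_def split: if_splits)
  qed
  then show ?thesis
    using d(1) by (intro that[of "min (d / 2) 1"]) auto
qed

text \<open>Bolzano's bisection principle: a property that is additive over adjacent intervals has
  to be checked only on short intervals around each point \<open>x\<close>. Such an interval meets
  \<open>T\<close> at most in \<open>x\<close>, so splitting it at \<open>x\<close> leaves two gaps
  of \<open>T\<close>.\<close>

lemma locally_finite_interval_induct:
  assumes "locally_finite T" "a \<le> b"
    and trans: "\<And>a b c. P a b \<Longrightarrow> P b c \<Longrightarrow> a \<le> b \<Longrightarrow> b \<le> c \<Longrightarrow> P a c"
    and refl: "\<And>a. P a a"
    and gap: "\<And>a b. a < b \<Longrightarrow> {a<..<b} \<inter> T = {} \<Longrightarrow> P a b"
  shows "P a b"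
  using \<open>a \<le> b\<close>
proof (induction rule: Bolzano)
  case (trans a b c)
  then show ?case by (rule assms(3))
next
  case (local x)
  obtain d where d: "d > 0" "{x - d..x + d} \<inter> T \<subseteq> {x}"
    using locally_finite_isolated[OF assms(1)] by blast
  have "P u v" if "u \<le> x" "x \<le> v" "v - u < d" for u v
  proof (rule assms(3)[of u x v])
    have "{u<..<x} \<inter> T \<subseteq> {x - d..x + d} \<inter> T" "{x<..<v} \<inter> T \<subseteq> {x - d..x + d} \<inter> T"
      using that by auto
    then have "{u<..<x} \<inter> T = {}" "{x<..<v} \<inter> T = {}"
      using d(2) by auto
    then show "P u x" "P x v"
      using that refl[of x] gap[of u x] gap[of x v] by (cases "u = x"; cases "x = v"; auto)+
  qed (use that in auto)
  then show ?case
    using d(1) by auto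
qed

text \<open>
  Breakpoint sets indexed by their elements, unlike the enumerations in \<open>piecewise_smooth\<close>, can be
  merged by taking unions.
\<close>

definition smooth_off :: "real set \<Rightarrow> (real \<Rightarrow> real) \<Rightarrow> bool" where
  "smooth_off T f \<longleftrightarrow> locally_finite T \<and>
     (\<forall>a b. a < b \<longrightarrow> {a<..<b} \<inter> T = {} \<longrightarrow> (\<exists>g. smooth g \<and> (\<forall>t\<in>{a..<b}. f t = g t)))"

section \<open>Breakpoint sets and their enumerations\<close>

lemma locally_finite_range:
  fixes s :: "int \<Rightarrow> real"
  assumes "mono s" "filterlim s at_top at_top" "filterlim s at_bot at_bot"
  shows "locally_finite (range s)"
  unfolding locally_finite_def
proof (intro allI)
  fix a b
  obtain N where N: "\<And>i. i \<ge> N \<Longrightarrow> s i > b"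
    using assms(2) by (auto simp: filterlim_at_top_dense eventually_at_top_linorder)
  obtain K where K: "\<And>i. i \<le> K \<Longrightarrow> s i < a"
    using assms(3) by (auto simp: filterlim_at_bot_dense eventually_at_bot_linorder)
  have "range s \<inter> {a..b} \<subseteq> s ` {K..N}"
  proof
    fix t assume "t \<in> range s \<inter> {a..b}"
    then obtain i where i: "t = s i" "a \<le> s i" "s i \<le> b" by auto
    then have "i \<in> {K..N}" using N[of i] K[of i] by force
    with i show "t \<in> s ` {K..N}" by blast
  qed
  then show "finite (range s \<inter> {a..b})"
    by (rule finite_subset) simp
qed

lemma int_seq_bracket:
  fixes s :: "int \<Rightarrow> real"
  assumes "filterlim s at_top at_top" "filterlim s at_bot at_bot"
  obtains i where "s i \<le> a" "a < s (i + 1)"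
proof -
  obtain N where N: "\<And>i. i \<ge> N \<Longrightarrow> s i > a"
    using assms(1) by (auto simp: filterlim_at_top_dense eventually_at_top_linorder)
  obtain K where K: "\<And>i. i \<le> K \<Longrightarrow> s i < a"
    using assms(2) by (auto simp: filterlim_at_bot_dense eventually_at_bot_linorder)
  let ?A = "{i \<in> {K..N}. s i \<le> a}"
  have "K \<in> ?A"
    using K[of K] N[of K] by force
  moreover have fin: "finite ?A"
    by (rule finite_subset[of _ "{K..N}"]) auto
  ultimately have "Max ?A \<in> ?A" by (intro Max_in) auto
  moreover have "a < s (Max ?A + 1)"
  proof (rule ccontr)
    assume *: "\<not> a < s (Max ?A + 1)"
    then have "Max ?A + 1 \<le> N"
      using N[of "Max ?A + 1"] by linarith
    then have "Max ?A + 1 \<in> ?A"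
      using * \<open>Max ?A \<in> ?A\<close> by auto
    then have "Max ?A + 1 \<le> Max ?A" by (intro Max_ge fin)
    then show False by simp
  qed
  ultimately show ?thesis using that by blast
qed

lemma piecewise_smooth_imp_smooth_off:
  assumes "piecewise_smooth f"
  shows "\<exists>T. smooth_off T f"
proof -
  obtain s g where s: "strict_mono (s :: int \<Rightarrow> real)" "filterlim s at_top at_top" "filterlim s at_bot at_bot"
    and g: "\<And>i. smooth (g i)" "\<And>i t. t \<in> {s i..<s (i + 1)} \<Longrightarrow> f t = g i t"
    using assms unfolding piecewise_smooth_def by blast
  have "\<exists>g. smooth g \<and> (\<forall>t\<in>{a..<b}. f t = g t)" if "a < b" "{a<..<b} \<inter> range s = {}" for a b
  proof -
    \<comment> \<open>The piece that contains \<open>a\<close> reaches at least to \<open>b\<close>,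
      since its right end is itself a breakpoint and cannot lie in the gap.\<close>
    obtain i where i: "s i \<le> a" "a < s (i + 1)"
      using int_seq_bracket[OF s(2,3)] by blast
    have "s (i + 1) \<notin> {a<..<b}" using that by blast
    then have "b \<le> s (i + 1)" using i that by auto
    then show ?thesis
      using g[of i] g(2)[of _ i] i by (intro exI[of _ "g i"]) auto
  qed
  moreover have "locally_finite (range s)"
    using s by (intro locally_finite_range strict_mono_mono)
  ultimately show ?thesis
    unfolding smooth_off_def by blast
qed

text \<open>\<open>T\<close> may be finite or bounded on one side, so the integers are added: then
  every point has a next and a previous element of \<open>U\<close> within distance 1. The sequence
  \<open>s\<close> starts at 0 and follows these neighbours in both directions; extra breakpoints do
  no harm.\<close>

lemma locally_finite_enumerate:
  assumes "locally_finite T"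
  obtains s :: "int \<Rightarrow> real" where "strict_mono s" "filterlim s at_top at_top" "filterlim s at_bot at_bot"
    "\<And>i. {s i<..<s (i + 1)} \<inter> T = {}"
proof -
  define U where "U = T \<union> range real_of_int"
  define up where "up t = Min (U \<inter> {t<..t + 1})" for t
  define dn where "dn t = Max (U \<inter> {t - 1..<t})" for t
  define s where "s i = (if i \<ge> 0 then (up ^^ nat i) 0 else (dn ^^ nat (- i)) 0)" for i :: int
  have "locally_finite (range real_of_int)"
  proof (rule locally_finite_range)
    show "mono real_of_int" by (simp add: mono_def)
    show "filterlim real_of_int at_top at_top"
      by (simp add: filterlim_real_of_int_at_top)
    show "filterlim real_of_int at_bot at_bot"
      unfolding filterlim_at_bot eventually_at_bot_linorder
      by (meson floor_le_iff le_floor_iff order.trans of_int_le_iff of_int_floor_le)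
  qed
  then have U: "finite (U \<inter> {a..b})" for a b
    using locally_finite_Un[OF assms] by (simp add: U_def locally_finite_def)
  have up: "up t \<in> U" "t < up t" "{t<..<up t} \<inter> U = {}" for t
  proof -
    have fin: "finite (U \<inter> {t<..t + 1})"
      by (rule finite_subset[OF _ U[of t "t + 1"]]) auto
    have "real_of_int (\<lfloor>t\<rfloor> + 1) \<in> U \<inter> {t<..t + 1}"
      unfolding U_def using floor_correct[of t] by (auto simp del: of_int_add) linarith+
    then have up: "up t \<in> U \<inter> {t<..t + 1}"
      unfolding up_def using fin by (intro Min_in) auto
    moreover have "up t \<le> x" if "x \<in> {t<..<up t} \<inter> U" for x
      using that up fin unfolding up_def by (intro Min_le) auto
    ultimately show "up t \<in> U" "t < up t" "{t<..<up t} \<inter> U = {}"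
      by force+
  qed
  have dn: "dn t \<in> U" "dn t < t" "{dn t<..<t} \<inter> U = {}" for t
  proof -
    have fin: "finite (U \<inter> {t - 1..<t})"
      by (rule finite_subset[OF _ U[of "t - 1" t]]) auto
    have "real_of_int (\<lceil>t\<rceil> - 1) \<in> U \<inter> {t - 1..<t}"
      unfolding U_def using ceiling_correct[of t] by (auto simp del: of_int_diff) linarith+
    then have dn: "dn t \<in> U \<inter> {t - 1..<t}"
      unfolding dn_def using fin by (intro Max_in) auto
    moreover have "x \<le> dn t" if "x \<in> {dn t<..<t} \<inter> U" for x
      using that dn fin unfolding dn_def by (intro Max_ge) auto
    ultimately show "dn t \<in> U" "dn t < t" "{dn t<..<t} \<inter> U = {}"
      by force+
  qed
  \<comment> \<open>Backward steps are counted by \<open>nat (- i)\<close>, so for negative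
    \<open>i\<close> the relation reads from \<open>i + 1\<close> down to \<open>i\<close>; at
    \<open>i = -1\<close> the two branches of \<open>s\<close> meet in 0.\<close>
  have step: "s (i + 1) = up (s i) \<or> s i = dn (s (i + 1))" for i
  proof (cases "i \<ge> 0")
    case True
    then have "nat (i + 1) = Suc (nat i)" by simp
    then show ?thesis using True by (simp add: s_def)
  next
    case False
    then have "nat (- i) = Suc (nat (- (i + 1)))" by simp
    moreover have "s (i + 1) = (dn ^^ nat (- (i + 1))) 0"
      using False by (cases "i = -1") (auto simp: s_def)
    ultimately show ?thesis using False by (simp add: s_def)
  qed
  have "0 \<in> U"
    unfolding U_def by (metis UnI2 of_int_0 rangeI)
  then have "(up ^^ k) 0 \<in> U" "(dn ^^ k) 0 \<in> U" for k
    using up(1) dn(1) by (cases k; simp)+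
  then have sU: "s i \<in> U" for i
    by (simp add: s_def)
  have less: "s i < s (i + 1)" for i
    using step[of i] up(2) dn(2) by metis
  have sm: "strict_mono s"
  proof
    fix i j :: int assume "i < j"
    then show "s i < s j"
      by (induction j rule: int_gr_induct) (use less less_trans in blast)+
  qed
  then have inj: "inj s" by (rule strict_mono_imp_inj_on)
  have "filterlim s at_top at_top"
    unfolding filterlim_at_top
  proof
    fix B
    have "\<exists>N. s N > B"
    proof (rule ccontr)
      assume "\<nexists>N. s N > B"
      then have "s ` {0..} \<subseteq> U \<inter> {s 0..B}"
        using sU sm by (auto simp: not_less strict_mono_less_eq)
      then have "finite (s ` {0..})"
        using U finite_subset by blast
      then show False
        using inj finite_imageD inj_on_subset infinite_Ici by (metis subset_UNIV)
    qed
    then obtain N where "s N > B" ..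
    then have "s i \<ge> B" if "i \<ge> N" for i
      using sm that by (meson less_imp_le order_trans strict_mono_less_eq)
    then show "eventually (\<lambda>i. B \<le> s i) at_top"
      unfolding eventually_at_top_linorder by blast
  qed
  moreover have "filterlim s at_bot at_bot"
    unfolding filterlim_at_bot
  proof
    fix B
    have "\<exists>N. s N < B"
    proof (rule ccontr)
      assume "\<nexists>N. s N < B"
      then have "s ` {..0} \<subseteq> U \<inter> {B..s 0}"
        using sU sm by (auto simp: not_less strict_mono_less_eq)
      then have "finite (s ` {..0})"
        using U finite_subset by blast
      then show False
        using inj finite_imageD inj_on_subset infinite_Iic by (metis subset_UNIV)
    qed
    then obtain N where "s N < B" ..
    then have "s i \<le> B" if "i \<le> N" for i
      using sm that by (meson less_imp_le order_trans strict_mono_less_eq)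
    then show "eventually (\<lambda>i. s i \<le> B) at_bot"
      unfolding eventually_at_bot_linorder by blast
  qed
  moreover have "{s i<..<s (i + 1)} \<inter> T = {}" for i
    using step[of i] up(3)[of "s i"] dn(3)[of "s (i + 1)"] by (auto simp: U_def)
  ultimately show ?thesis
    using that sm by blast
qed

lemma piecewise_smooth_iff: "piecewise_smooth f \<longleftrightarrow> (\<exists>T. smooth_off T f)"
proof
  assume "\<exists>T. smooth_off T f"
  then obtain T where T: "locally_finite T"
    "\<And>a b. a < b \<Longrightarrow> {a<..<b} \<inter> T = {} \<Longrightarrow> \<exists>g. smooth g \<and> (\<forall>t\<in>{a..<b}. f t = g t)"
    unfolding smooth_off_def by blast
  obtain s :: "int \<Rightarrow> real" where s: "strict_mono s" "filterlim s at_top at_top"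
    "filterlim s at_bot at_bot" "\<And>i. {s i<..<s (i + 1)} \<inter> T = {}"
    using locally_finite_enumerate[OF T(1)] by blast
  have "\<exists>g. smooth g \<and> (\<forall>t\<in>{s i..<s (i + 1)}. f t = g t)" for i
    using s(1,4) by (intro T(2)) (auto simp: strict_mono_less)
  then obtain g where "\<And>i. smooth (g i) \<and> (\<forall>t\<in>{s i..<s (i + 1)}. f t = g i t)"
    by metis
  then show "piecewise_smooth f"
    unfolding piecewise_smooth_def using s by blast
qed (rule piecewise_smooth_imp_smooth_off)

section \<open>Linear combinations and one-sided limits\<close>

lemma smooth_off_mono: "smooth_off T f \<Longrightarrow> T \<subseteq> U \<Longrightarrow> locally_finite U \<Longrightarrow> smooth_off U f"
  unfolding smooth_off_def by blast

lemma smooth_off_lincomb: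
  assumes "smooth_off T f" "smooth_off T g"
  shows "smooth_off T (\<lambda>t. a * f t + b * g t)"
proof -
  have "\<exists>h. smooth h \<and> (\<forall>t\<in>{u..<v}. a * f t + b * g t = h t)" if uv: "u < v" "{u<..<v} \<inter> T = {}" for u v
  proof -
    obtain f' g' where "smooth f'" "smooth g'" "\<forall>t\<in>{u..<v}. f t = f' t" "\<forall>t\<in>{u..<v}. g t = g' t"
      using assms uv unfolding smooth_off_def by blast
    then show ?thesis
      by (intro exI[of _ "\<lambda>t. a * f' t + b * g' t"]) (auto intro!: smooth_add smooth_mult smooth_const)
  qed
  then show ?thesis
    using assms(1) by (auto simp: smooth_off_def)
qed

lemma piecewise_smooth_lincomb:
  assumes "piecewise_smooth f" "piecewise_smooth g"
  shows "piecewise_smooth (\<lambda>t. a * f t + b * g t)"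
proof -
  obtain S T where "smooth_off S f" "smooth_off T g"
    using assms piecewise_smooth_iff by auto
  moreover from this have "locally_finite (S \<union> T)"
    by (auto simp: smooth_off_def intro: locally_finite_Un)
  ultimately have "smooth_off (S \<union> T) f" "smooth_off (S \<union> T) g"
    by (blast intro: smooth_off_mono)+
  then show ?thesis
    using smooth_off_lincomb piecewise_smooth_iff by blast
qed

lemma smooth_imp_smooth_off: "smooth f \<Longrightarrow> smooth_off {} f"
  by (auto simp: smooth_off_def locally_finite_def)

lemma smooth_off_right_germ:
  assumes "smooth_off T f"
  obtains b g where "t < b" "smooth g" "\<And>x. x \<in> {t..<b} \<Longrightarrow> f x = g x"
proof -
  obtain d where d: "d > 0" "{t - d..t + d} \<inter> T \<subseteq> {t}"
    using locally_finite_isolated assms by (metis smooth_off_def)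
  have "{t<..<t + d} \<inter> T \<subseteq> ({t - d..t + d} \<inter> T) - {t}" using d(1) by auto
  then have "{t<..<t + d} \<inter> T = {}" using d(2) by blast
  then show ?thesis
    using assms d(1) that[of "t + d"] unfolding smooth_off_def by (metis less_add_same_cancel1)
qed

lemma smooth_off_left_germ:
  assumes "smooth_off T f"
  obtains a g where "a < t" "smooth g" "\<And>x. x \<in> {a..<t} \<Longrightarrow> f x = g x"
proof -
  obtain d where d: "d > 0" "{t - d..t + d} \<inter> T \<subseteq> {t}"
    using locally_finite_isolated assms by (metis smooth_off_def)
  have "{t - d<..<t} \<inter> T \<subseteq> ({t - d..t + d} \<inter> T) - {t}" using d(1) by auto
  then have "{t - d<..<t} \<inter> T = {}" using d(2) by blast
  then show ?thesis
    using assms d(1) that[of "t - d"] unfolding smooth_off_def by (metis diff_less_eq less_add_same_cancel1)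
qed

lemma piecewise_smooth_at_right:
  assumes "piecewise_smooth f"
  shows "(f \<longlongrightarrow> f t) (at_right t)"
proof -
  obtain b g where g: "t < b" "smooth g" "\<And>x. x \<in> {t..<b} \<Longrightarrow> f x = g x"
    using assms smooth_off_right_germ piecewise_smooth_iff by metis
  have "eventually (\<lambda>x. g x = f x) (at_right t)"
    using g by (auto simp: eventually_at_right_field intro!: exI[of _ b])
  moreover have "(g \<longlongrightarrow> g t) (at_right t)"
    using g by (intro smooth_tendsto)
  ultimately show ?thesis
    using g by (auto intro: Lim_transform_eventually)
qed

text \<open>The smooth function of the piece to the left of \<open>t\<close> extends beyond that
  piece, so the left limit exists; this justifies the use of \<open>Lim\<close>.\<close>

lemma piecewise_smooth_at_left:
  assumes "piecewise_smooth f"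
  shows "(f \<longlongrightarrow> Lim (at_left t) f) (at_left t)"
proof -
  obtain a g where g: "a < t" "smooth g" "\<And>x. x \<in> {a..<t} \<Longrightarrow> f x = g x"
    using assms smooth_off_left_germ piecewise_smooth_iff by metis
  have "eventually (\<lambda>x. g x = f x) (at_left t)"
    using g by (auto simp: eventually_at_left_field intro!: exI[of _ a])
  moreover have "(g \<longlongrightarrow> g t) (at_left t)"
    using g by (intro smooth_tendsto)
  ultimately have "(f \<longlongrightarrow> g t) (at_left t)"
    by (auto intro: Lim_transform_eventually)
  then show ?thesis
    by (metis tendsto_Lim trivial_limit_at_left_real)
qed

section \<open>Uniqueness of the decomposition\<close>

lemma apply_test_deriv_pow: "apply_test ((deriv_test ^^ k) \<phi>) = (deriv ^^ k) (apply_test \<phi>)"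
  by (induction k) (simp_all add: deriv_test.rep_eq)

lemma ddt_pow: "(ddt ^^ k) D \<phi> = (- 1) ^ k * D ((deriv_test ^^ k) \<phi>)"
proof (induction k arbitrary: \<phi>)
  case (Suc k)
  have "(ddt ^^ Suc k) D \<phi> = - (ddt ^^ k) D (deriv_test \<phi>)"
    by (simp add: ddt_def[of "(ddt ^^ k) D"])
  then show ?case
    by (simp add: Suc funpow_swap1)
qed simp

text \<open>Up to sign, the k-th derivative of the Dirac impulse evaluates the k-th derivative of
  the test function at \<open>t\<close>, so only the germ of the test function at \<open>t\<close>
  matters.\<close>

lemma dirac_span_local:
  assumes "D \<in> dirac_span t" "eventually (\<lambda>x. apply_test \<phi> x = apply_test \<psi> x) (nhds t)"
  shows "D \<phi> = D \<psi>"
proof -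
  have "(ddt ^^ k) (dirac t) \<phi> = (ddt ^^ k) (dirac t) \<psi>" for k
    using higher_deriv_cong_ev[OF assms(2) refl]
    by (simp add: ddt_pow dirac_def apply_test_deriv_pow)
  then show ?thesis
    using assms(1) by (auto simp: dirac_span_def)
qed

lemma dirac_span_eq_0:
  assumes "D \<in> dirac_span t" "eventually (\<lambda>x. apply_test \<phi> x = 0) (nhds t)"
  shows "D \<phi> = 0"
proof -
  have zero: "(deriv ^^ k) (\<lambda>_. 0) = (\<lambda>_. 0 :: real)" for k
    by (induction k) (simp_all add: deriv_zero_fun)
  have "(ddt ^^ k) (dirac t) \<phi> = 0" for k
    using higher_deriv_cong_ev[of "apply_test \<phi>" "\<lambda>_. 0", OF assms(2) refl]
    by (simp add: ddt_pow dirac_def apply_test_deriv_pow zero)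
  then show ?thesis
    using assms(1) by (auto simp: dirac_span_def)
qed

lemma dirac_span_lincomb:
  assumes "D \<in> dirac_span t" "D' \<in> dirac_span t"
  shows "(\<lambda>\<phi>. a * D \<phi> + b * D' \<phi>) \<in> dirac_span t"
proof -
  let ?d = "\<lambda>k. (ddt ^^ k) (dirac t)"
  obtain m c where D: "D = (\<lambda>\<phi>. \<Sum>k<m. c k * ?d k \<phi>)"
    using assms(1) by (auto simp: dirac_span_def)
  obtain m' c' where D': "D' = (\<lambda>\<phi>. \<Sum>k<m'. c' k * ?d k \<phi>)"
    using assms(2) by (auto simp: dirac_span_def)
  let ?e = "\<lambda>k. a * (if k < m then c k else 0) + b * (if k < m' then c' k else 0)"
  have "a * D \<phi> + b * D' \<phi> = (\<Sum>k<max m m'. ?e k * ?d k \<phi>)" for \<phi>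
  proof -
    have "D \<phi> = (\<Sum>k<max m m'. (if k < m then c k else 0) * ?d k \<phi>)"
      unfolding D by (rule sum.mono_neutral_cong_left) auto
    moreover have "D' \<phi> = (\<Sum>k<max m m'. (if k < m' then c' k else 0) * ?d k \<phi>)"
      unfolding D' by (rule sum.mono_neutral_cong_left) auto
    ultimately show ?thesis
      by (simp only: sum_distrib_left sum.distrib[symmetric] distrib_right mult.assoc)
  qed
  then show ?thesis
    unfolding dirac_span_def by (intro CollectI exI[of _ "max m m'"] exI[of _ ?e]) (rule ext)
qed

lemma ddt_dirac_span:
  assumes "D \<in> dirac_span t"
  shows "ddt D \<in> dirac_span t"
proof -
  let ?d = "\<lambda>k. (ddt ^^ k) (dirac t)"
  obtain m c where D: "D = (\<lambda>\<phi>. \<Sum>k<m. c k * ?d k \<phi>)"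
    using assms by (auto simp: dirac_span_def)
  \<comment> \<open>Differentiation raises each order by one: the coefficients shift and a leading 0
    is inserted.\<close>
  let ?c = "case_nat 0 c"
  have "ddt D \<phi> = (\<Sum>k<Suc m. ?c k * ?d k \<phi>)" for \<phi>
    unfolding D sum.lessThan_Suc_shift by (simp add: ddt_def sum_negf)
  then show ?thesis
    unfolding dirac_span_def by (intro CollectI exI[of _ "Suc m"] exI[of _ ?c]) (rule ext)
qed

lemma dirac_in_span: "(\<lambda>\<phi>. a * dirac t \<phi>) \<in> dirac_span t"
  unfolding dirac_span_def by (auto intro!: exI[of _ "Suc 0"] exI[of _ "\<lambda>_. a"])

lemma zero_in_dirac_span: "0 \<in> dirac_span t"
  unfolding dirac_span_def by (auto intro!: exI[of _ 0])

section \<open>Locally finite families of impulses\<close>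

definition impulsive :: "(real \<Rightarrow> dist) \<Rightarrow> bool" where
  "impulsive P \<longleftrightarrow> locally_finite {t. P t \<noteq> 0} \<and> (\<forall>t. P t \<in> dirac_span t)"

lemma pw_decomp_iff:
  "pw_decomp D f P \<longleftrightarrow> piecewise_smooth f \<and> impulsive P \<and>
     D = (\<lambda>\<phi>. dist_of_fun f \<phi> + (\<Sum>\<^sub>\<infinity>t\<in>UNIV. P t \<phi>))"
  by (auto simp: pw_decomp_def impulsive_def plus_fun_def)

text \<open>The support of \<open>\<phi>\<close> is bounded and hence meets only finitely many
  impulse times. This reduces every infinite sum of impulses to a finite one.\<close>

lemma impulsive_finite:
  assumes "impulsive P"
  shows "finite {t. P t \<phi> \<noteq> 0}"
proof -
  obtain R where R: "R > 0" "\<And>x. \<bar>x\<bar> \<ge> R \<Longrightarrow> apply_test \<phi> x = 0"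
    using test_fun_support by blast
  have "P t \<phi> = 0" if "t \<notin> {-R..R}" for t
  proof (rule dirac_span_eq_0)
    have "eventually (\<lambda>x. x \<in> - {-R..R}) (nhds t)"
      using that by (intro eventually_nhds_in_open) auto
    then show "eventually (\<lambda>x. apply_test \<phi> x = 0) (nhds t)"
      by eventually_elim (auto intro!: R(2))
  qed (use assms impulsive_def in auto)
  then have "{t. P t \<phi> \<noteq> 0} \<subseteq> {t. P t \<noteq> 0} \<inter> {-R..R}"
    by (auto simp: zero_fun_def simp del: atLeastAtMost_iff)
  then show ?thesis
    using assms unfolding impulsive_def locally_finite_def by (meson finite_subset)
qed

lemma impulsive_summable:
  assumes "impulsive P"
  shows "(\<lambda>t. P t \<phi>) summable_on J"
proof -
  have "(\<lambda>t. P t \<phi>) summable_on (J \<inter> {t. P t \<phi> \<noteq> 0})"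
    using impulsive_finite[OF assms] by (intro summable_on_finite) auto
  then show ?thesis
    by (rule summable_on_cong_neutral[THEN iffD1, rotated -1]) auto
qed

lemma impulsive_lincomb:
  assumes "impulsive P" "impulsive Q"
  shows "impulsive (\<lambda>t \<phi>. a * P t \<phi> + b * Q t \<phi>)"
  unfolding impulsive_def
proof
  show "locally_finite {t. (\<lambda>\<phi>. a * P t \<phi> + b * Q t \<phi>) \<noteq> 0}"
  proof (rule locally_finite_subset)
    show "locally_finite ({t. P t \<noteq> 0} \<union> {t. Q t \<noteq> 0})"
      using assms by (auto simp: impulsive_def intro: locally_finite_Un)
  qed (auto simp: zero_fun_def)
qed (use assms dirac_span_lincomb impulsive_def in auto)

lemma infsum_impulsive_lincomb:
  assumes "impulsive P" "impulsive Q"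
  shows "(\<Sum>\<^sub>\<infinity>t\<in>J. a * P t \<phi> + b * Q t \<phi>) = a * (\<Sum>\<^sub>\<infinity>t\<in>J. P t \<phi>) + b * (\<Sum>\<^sub>\<infinity>t\<in>J. Q t \<phi>)"
  using impulsive_summable[OF assms(1)] impulsive_summable[OF assms(2)]
  by (simp add: infsum_add infsum_cmult_right summable_on_cmult_right)

section \<open>Integrals against test functions\<close>

lemma smooth_off_set_integrable:
  assumes "smooth_off T f" "continuous_on UNIV g" "a \<le> b"
  shows "set_integrable lborel {a..<b} (\<lambda>x. f x * g x)"
proof (rule locally_finite_interval_induct[where T = T and P = "\<lambda>a b. set_integrable lborel {a..<b} (\<lambda>x. f x * g x)"])
  show "locally_finite T" using assms(1) by (simp add: smooth_off_def)
next
  fix a b c :: real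
  assume *: "set_integrable lborel {a..<b} (\<lambda>x. f x * g x)" "set_integrable lborel {b..<c} (\<lambda>x. f x * g x)"
    "a \<le> b" "b \<le> c"
  then have "{a..<b} \<union> {b..<c} = {a..<c}" by auto
  then show "set_integrable lborel {a..<c} (\<lambda>x. f x * g x)"
    using set_integrable_Un[OF *(1,2)] by simp
next
  fix a b :: real
  assume "a < b" "{a<..<b} \<inter> T = {}"
  then obtain h where h: "smooth h" "\<And>t. t \<in> {a..<b} \<Longrightarrow> f t = h t"
    using assms(1) unfolding smooth_off_def by blast
  \<comment> \<open>The smooth extension \<open>h\<close> is integrable on the closed interval by
    continuity; this is then cut down to the half-open interval, where \<open>h\<close> agrees with
    \<open>f\<close>.\<close>
  have "set_integrable lborel {a..b} (\<lambda>x. h x * g x)"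
    unfolding set_integrable_def
    by (intro borel_integrable_compact continuous_intros smooth_continuous h continuous_on_subset[OF assms(2)]) auto
  then have "set_integrable lborel {a..<b} (\<lambda>x. h x * g x)"
    by (rule set_integrable_subset) auto
  then show "set_integrable lborel {a..<b} (\<lambda>x. f x * g x)"
    by (rule set_integrable_cong[THEN iffD1, rotated -1]) (auto simp: h)
qed (use assms in \<open>auto simp: set_integrable_def\<close>)

lemma test_continuous: "continuous_on A (apply_test \<phi>)"
  by (rule smooth_continuous[OF smooth_apply_test])

lemma piecewise_smooth_test_integrable:
  assumes "piecewise_smooth f"
  shows "integrable lborel (\<lambda>x. f x * apply_test \<phi> x)"
proof -
  obtain T where T: "smooth_off T f" using assms piecewise_smooth_iff by blast
  obtain R where R: "R > 0" "\<And>x. \<bar>x\<bar> \<ge> R \<Longrightarrow> apply_test \<phi> x = 0"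
    using test_fun_support by blast
  have "set_integrable lborel {-R..<R} (\<lambda>x. f x * apply_test \<phi> x)"
    using T R by (intro smooth_off_set_integrable test_continuous) auto
  then show ?thesis
    unfolding set_integrable_def
    by (rule back_subst[of "integrable lborel"]) (auto simp: fun_eq_iff indicator_def intro!: R(2))
qed

lemma dist_of_fun_lincomb_on:
  assumes "piecewise_smooth f" "piecewise_smooth g" "J \<in> sets borel"
  shows "dist_of_fun (\<lambda>t. indicator J t * (a * f t + b * g t)) \<phi> =
    a * dist_of_fun (\<lambda>t. indicator J t * f t) \<phi> + b * dist_of_fun (\<lambda>t. indicator J t * g t) \<phi>"
proof -
  have int: "integrable lborel (\<lambda>x. indicator J x * f x * apply_test \<phi> x)"
    if "piecewise_smooth f" for f
    using integrable_mult_indicator[OF _ piecewise_smooth_test_integrable[OF that], of J \<phi>] assms(3)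
    by (simp add: mult.assoc)
  have "dist_of_fun (\<lambda>t. indicator J t * (a * f t + b * g t)) \<phi> =
      (LINT x|lborel. a * (indicator J x * f x * apply_test \<phi> x) + b * (indicator J x * g x * apply_test \<phi> x))"
    by (simp add: dist_of_fun_def algebra_simps)
  also have "\<dots> = a * dist_of_fun (\<lambda>t. indicator J t * f t) \<phi> + b * dist_of_fun (\<lambda>t. indicator J t * g t) \<phi>"
    unfolding dist_of_fun_def
    by (subst Bochner_Integration.integral_add) (use int[OF assms(1)] int[OF assms(2)] in auto)
  finally show ?thesis .
qed

lemma dist_of_fun_lincomb:
  assumes "piecewise_smooth f" "piecewise_smooth g"
  shows "dist_of_fun (\<lambda>t. a * f t + b * g t) \<phi> = a * dist_of_fun f \<phi> + b * dist_of_fun g \<phi>"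
  using dist_of_fun_lincomb_on[OF assms, of UNIV] by simp

section \<open>Linearity and uniqueness of decompositions\<close>

lemma pw_decomp_lincomb:
  assumes "pw_decomp D f P" "pw_decomp D' g Q"
  shows "pw_decomp (\<lambda>\<phi>. a * D \<phi> + b * D' \<phi>) (\<lambda>t. a * f t + b * g t) (\<lambda>t \<phi>. a * P t \<phi> + b * Q t \<phi>)"
  using assms unfolding pw_decomp_iff
  by (auto simp: piecewise_smooth_lincomb impulsive_lincomb dist_of_fun_lincomb infsum_impulsive_lincomb
      algebra_simps)

text \<open>If \<open>f t\<close> were nonzero, right-continuity would fix the sign of
  \<open>f\<close> on some interval \<open>(t, c)\<close> that carries no impulse. A test function
  that is positive on a shorter interval inside would give a nonzero integral, although all impulses
  vanish on it.\<close>

lemma pw_decomp_0_fun: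
  assumes "pw_decomp 0 f P"
  shows "f = (\<lambda>_. 0)"
proof (rule ext, rule ccontr)
  fix t assume ft: "f t \<noteq> 0"
  have f: "piecewise_smooth f" and P: "impulsive P"
    and eq: "dist_of_fun f \<phi> + (\<Sum>\<^sub>\<infinity>t\<in>UNIV. P t \<phi>) = 0" for \<phi>
    using assms by (auto simp: pw_decomp_iff zero_fun_def fun_eq_iff)
  have "((\<lambda>x. f t * f x) \<longlongrightarrow> f t * f t) (at_right t)"
    by (intro tendsto_intros piecewise_smooth_at_right f)
  \<comment> \<open>The product with \<open>f t\<close> treats both signs of \<open>f t\<close> at
    once.\<close>
  then have "eventually (\<lambda>x. f t * f x > 0) (at_right t)"
    using ft by (auto intro: order_tendstoD not_square_less_zero simp: zero_less_mult_iff linorder_neq_iff)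
  then obtain b where b: "t < b" "\<And>x. t < x \<Longrightarrow> x < b \<Longrightarrow> f t * f x > 0"
    by (auto simp: eventually_at_right_field)
  obtain d where d: "d > 0" "{t - d..t + d} \<inter> {t. P t \<noteq> 0} \<subseteq> {t}"
    using locally_finite_isolated P by (metis impulsive_def)
  define c where "c = min b (t + d)"
  \<comment> \<open>A quarter of the length, so that the support \<open>[t + l, t + 3 * l]\<close>
    keeps the distance \<open>l\<close> from \<open>t\<close> and from \<open>c\<close>.\<close>
  define l where "l = (c - t) / 4"
  have l: "l > 0" "c = t + 4 * l"
    using b(1) d(1) by (auto simp: l_def c_def field_simps)
  have "t + l < t + 2 * l" "t + 2 * l \<le> t + 2 * l" "t + 2 * l < t + 3 * l"
    using l by auto
  then obtain \<psi> where \<psi>: "\<And>x. x \<notin> {t + l<..<t + 3 * l} \<Longrightarrow> apply_test \<psi> x = 0"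
    "\<And>x. x \<in> {t + l<..<t + 3 * l} \<Longrightarrow> apply_test \<psi> x > 0"
    by (rule cutoff_exists) blast
  have "P s \<psi> = 0" for s
  proof (cases "s \<in> {t<..<c}")
    case True
    then have "s \<in> {t - d..t + d}" "s \<noteq> t" by (auto simp: c_def)
    then have "P s = 0" using d(2) by blast
    then show ?thesis by simp
  next
    case False
    have "eventually (\<lambda>x. x \<in> - {t + l..t + 3 * l}) (nhds s)"
      using False l by (intro eventually_nhds_in_open) auto
    then have "eventually (\<lambda>x. apply_test \<psi> x = 0) (nhds s)"
      by eventually_elim (auto intro!: \<psi>(1))
    then show ?thesis
      using P dirac_span_eq_0 impulsive_def by blast
  qed
  then have "dist_of_fun f \<psi> = 0"
    using eq[of \<psi>] by simp
  then have int0: "(LINT x|lborel. f t * (f x * apply_test \<psi> x)) = 0"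
    by (simp add: dist_of_fun_def)
  have pos: "f t * (f x * apply_test \<psi> x) > 0" if "x \<in> {t + l<..<t + 3 * l}" for x
    using that b(2)[of x] \<psi>(2)[OF that] l by (auto simp: c_def mult.assoc[symmetric])
  have nn: "f t * (f x * apply_test \<psi> x) \<ge> 0" for x
    using pos[of x] \<psi>(1)[of x] by (cases "x \<in> {t + l<..<t + 3 * l}") auto
  \<comment> \<open>A nonnegative integrand with integral 0 vanishes almost everywhere, yet this one
    is positive on an interval of length \<open>2 * l\<close>.\<close>
  have "AE x in lborel. f t * (f x * apply_test \<psi> x) = 0"
    using int0 nn by (subst (asm) integral_nonneg_eq_0_iff_AE)
      (auto intro: piecewise_smooth_test_integrable f)
  then obtain N where N: "{x \<in> space lborel. \<not> f t * (f x * apply_test \<psi> x) = 0} \<subseteq> N"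
      "emeasure lborel N = 0" "N \<in> sets lborel"
    by (rule AE_E)
  have "{t + l<..<t + 3 * l} \<subseteq> N"
    using pos N(1) by (force simp del: greaterThanLessThan_iff)
  then have "emeasure lborel {t + l<..<t + 3 * l} \<le> 0"
    using N(2,3) emeasure_mono by metis
  then show False
    using l by simp
qed

text \<open>The function part is already known to vanish. Multiplying \<open>\<phi>\<close> by a
  cutoff that is 1 near \<open>t\<close> and whose support contains no other impulse time preserves
  the germ at \<open>t\<close>, so the sum of all impulses reduces to
  \<open>P t \<phi>\<close>.\<close>

lemma pw_decomp_0_impulse:
  assumes "pw_decomp 0 f P"
  shows "P = (\<lambda>_. 0)"
proof (intro ext)
  fix t \<phi>
  have P: "impulsive P" and eq: "(\<Sum>\<^sub>\<infinity>t\<in>UNIV. P t \<phi>) = 0" for \<phi>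
    using assms pw_decomp_0_fun[OF assms]
    by (auto simp: pw_decomp_iff zero_fun_def fun_eq_iff dist_of_fun_def)
  obtain d where d: "d > 0" "{t - d..t + d} \<inter> {t. P t \<noteq> 0} \<subseteq> {t}"
    using locally_finite_isolated P by (metis impulsive_def)
  have "t - d < t - d / 2" "t - d / 2 \<le> t + d / 2" "t + d / 2 < t + d"
    using d(1) by auto
  then obtain \<psi> where \<psi>: "\<And>x. x \<notin> {t - d<..<t + d} \<Longrightarrow> apply_test \<psi> x = 0"
    "\<And>x. x \<in> {t - d / 2..t + d / 2} \<Longrightarrow> apply_test \<psi> x = 1"
    by (rule cutoff_exists) blast
  have "apply_test \<psi> x * apply_test \<phi> x = 0" if "x \<notin> {t - d..t + d}" for x
    using that by (subst \<psi>(1)) auto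
  then obtain \<rho> where \<rho>: "apply_test \<rho> = (\<lambda>x. apply_test \<psi> x * apply_test \<phi> x)"
    by (rule test_fun_exists[OF smooth_mult[OF smooth_apply_test smooth_apply_test]])
  have "P s \<rho> = 0" if "s \<noteq> t" for s
  proof (cases "s \<in> {t - d..t + d}")
    case True
    then show ?thesis using d(2) that by (auto simp: zero_fun_def fun_eq_iff)
  next
    case False
    then have "eventually (\<lambda>x. x \<in> - {t - d..t + d}) (nhds s)"
      by (intro eventually_nhds_in_open) auto
    then have "eventually (\<lambda>x. apply_test \<rho> x = 0) (nhds s)"
      by eventually_elim (auto simp: \<rho> intro!: \<psi>(1))
    then show ?thesis
      using P dirac_span_eq_0 impulsive_def by blast
  qed
  then have "(\<Sum>\<^sub>\<infinity>t\<in>UNIV. P t \<rho>) = (\<Sum>\<^sub>\<infinity>t\<in>{t}. P t \<rho>)"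
    by (intro infsum_cong_neutral) auto
  then have "P t \<rho> = 0"
    using eq[of \<rho>] by simp
  moreover have "P t \<rho> = P t \<phi>"
  proof (rule dirac_span_local)
    have "eventually (\<lambda>x. x \<in> {t - d / 2<..<t + d / 2}) (nhds t)"
      using d(1) by (intro eventually_nhds_in_open) auto
    then show "eventually (\<lambda>x. apply_test \<rho> x = apply_test \<phi> x) (nhds t)"
      by eventually_elim (simp add: \<rho> \<psi>(2))
  qed (use P impulsive_def in auto)
  ultimately show "P t \<phi> = 0 \<phi>" by simp
qed

lemma pw_decomp_unique:
  assumes "pw_decomp D f P" "pw_decomp D g Q"
  shows "f = g" "P = Q"
proof -
  have *: "pw_decomp 0 (\<lambda>t. 1 * f t + (- 1) * g t) (\<lambda>t \<phi>. 1 * P t \<phi> + (- 1) * Q t \<phi>)"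
    using pw_decomp_lincomb[OF assms, of 1 "-1"] by (simp add: zero_fun_def)
  show "f = g"
    using pw_decomp_0_fun[OF *] by (simp add: fun_eq_iff)
  show "P = Q"
    using pw_decomp_0_impulse[OF *] by (simp add: fun_eq_iff)
qed

text \<open>By uniqueness, the definite descriptions \<open>fun_part\<close> and
  \<open>impulse\<close> can be read off from any decomposition that has been exhibited.\<close>

lemma pw_decomp_parts: "pw_decomp D f P \<Longrightarrow> fun_part D = f" "pw_decomp D f P \<Longrightarrow> impulse D = P"
  unfolding fun_part_def impulse_def
  by (rule the_equality; use pw_decomp_unique in blast)+

lemma pw_decomp_exists: "D \<in> pw_smooth_dist \<Longrightarrow> pw_decomp D (fun_part D) (impulse D)"
  unfolding pw_smooth_dist_def using pw_decomp_parts by blast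

section \<open>Derivatives and restrictions\<close>

definition right_deriv :: "(real \<Rightarrow> real) \<Rightarrow> real \<Rightarrow> real" where
  "right_deriv f t = (THE d. (f has_real_derivative d) (at t within {t..}))"

definition jump :: "(real \<Rightarrow> real) \<Rightarrow> real \<Rightarrow> real" where
  "jump f t = f t - Lim (at_left t) f"

lemma right_deriv_eq:
  assumes "smooth g" "\<And>x. x \<in> {a..<b} \<Longrightarrow> f x = g x" "t \<in> {a..<b}"
  shows "right_deriv f t = deriv g t"
proof -
  have "(g has_real_derivative deriv g t) (at t within {t..})"
    using smooth_has_deriv[OF assms(1)] DERIV_subset by blast
  then have "(f has_real_derivative deriv g t) (at t within {t..})"
    by (rule has_field_derivative_transform_within[where d = "b - t"])
      (use assms in \<open>auto simp: dist_real_def\<close>)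
  moreover have "at_right t \<le> at t within {t..}"
    by (intro at_le) auto
  then have "at t within {t..} \<noteq> bot"
    by (metis bot.extremum_unique trivial_limit_at_right_real)
  ultimately show ?thesis
    unfolding right_deriv_def by (intro the_equality has_field_derivative_unique)
qed

lemma Lim_at_left_eq:
  assumes "smooth g" "\<And>x. x \<in> {a..<t} \<Longrightarrow> f x = g x" "a < t"
  shows "Lim (at_left t) f = g t"
proof -
  have "eventually (\<lambda>x. g x = f x) (at_left t)"
    using assms by (auto simp: eventually_at_left_field intro!: exI[of _ a])
  moreover have "(g \<longlongrightarrow> g t) (at_left t)"
    using assms by (intro smooth_tendsto)
  ultimately have "(f \<longlongrightarrow> g t) (at_left t)"
    by (auto intro: Lim_transform_eventually)
  then show ?thesis
    by (intro tendsto_Lim) auto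
qed

text \<open>The two-sided derivative need not exist at breakpoints, whereas the right derivative
  agrees with the derivative of the piece also at its left end. So the same half-open pieces serve
  again.\<close>

lemma smooth_off_right_deriv:
  assumes "smooth_off T f"
  shows "smooth_off T (right_deriv f)"
  unfolding smooth_off_def
proof (intro conjI allI impI)
  show "locally_finite T" using assms by (simp add: smooth_off_def)
  fix a b :: real assume "a < b" "{a<..<b} \<inter> T = {}"
  then obtain g where g: "smooth g" "\<And>x. x \<in> {a..<b} \<Longrightarrow> f x = g x"
    using assms unfolding smooth_off_def by blast
  then have "right_deriv f t = deriv g t" if "t \<in> {a..<b}" for t
    using right_deriv_eq that by metis
  then show "\<exists>g. smooth g \<and> (\<forall>t\<in>{a..<b}. right_deriv f t = g t)"
    using smooth_deriv[OF g(1)] by blast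
qed

lemma jump_eq_0:
  assumes "smooth_off T f" "t \<notin> T"
  shows "jump f t = 0"
proof -
  obtain d where d: "d > 0" "{t - d..t + d} \<inter> T \<subseteq> {t}"
    using locally_finite_isolated assms by (metis smooth_off_def)
  have "{t - d<..<t + d} \<inter> T \<subseteq> {t - d..t + d} \<inter> T" by auto
  then have "{t - d<..<t + d} \<inter> T = {}" using d(2) assms(2) by blast
  moreover have "t - d < t + d" using d(1) by simp
  ultimately obtain g where g: "smooth g" "\<And>x. x \<in> {t - d..<t + d} \<Longrightarrow> f x = g x"
    using assms unfolding smooth_off_def by blast
  have "Lim (at_left t) f = g t"
    using g d by (intro Lim_at_left_eq[of g "t - d"]) auto
  then show ?thesis
    using g(2)[of t] d by (simp add: jump_def)
qed

text \<open>The formula is additive over adjacent intervals, so it suffices to treat a gap of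
  \<open>T\<close>. The sum runs over \<open>{a<..b}\<close> because \<open>f\<close> is
  right-continuous: \<open>f b\<close> already includes the jump at \<open>b\<close>, and
  \<open>f a\<close> the one at \<open>a\<close>.\<close>

lemma smooth_off_integration_by_parts:
  assumes f: "smooth_off T f" and h: "smooth h" and "a \<le> b"
  shows "((\<lambda>x. f x * deriv h x + right_deriv f x * h x) has_integral
     f b * h b - f a * h a - (\<Sum>t\<in>T \<inter> {a<..b}. jump f t * h t)) {a..b}" (is "?P a b")
proof (rule locally_finite_interval_induct[where T = T and P = ?P])
  show "locally_finite T" using f by (simp add: smooth_off_def)
  show "a \<le> b" by fact
next
  fix a b c
  assume *: "?P a b" "?P b c" and le: "a \<le> b" "b \<le> c"
  have fin: "finite (T \<inter> {a<..b})" for a b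
    using f by (auto simp: smooth_off_def locally_finite_def intro: finite_subset[of _ "T \<inter> {a..b}"])
  have "T \<inter> {a<..c} = (T \<inter> {a<..b}) \<union> (T \<inter> {b<..c})"
    using le by auto
  then have "(\<Sum>t\<in>T \<inter> {a<..c}. jump f t * h t) =
      (\<Sum>t\<in>T \<inter> {a<..b}. jump f t * h t) + (\<Sum>t\<in>T \<inter> {b<..c}. jump f t * h t)"
    using fin by (simp only:) (subst sum.union_disjoint; auto)
  then show "?P a c"
    using has_integral_combine[OF le *] by (simp add: algebra_simps)
next
  fix a b :: real
  assume ab: "a < b" "{a<..<b} \<inter> T = {}"
  then obtain g where g: "smooth g" "\<And>x. x \<in> {a..<b} \<Longrightarrow> f x = g x"
    using f unfolding smooth_off_def by blast
  have "((\<lambda>x. g x * deriv h x + deriv g x * h x) has_integral g b * h b - g a * h a) {a..b}"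
  proof (rule fundamental_theorem_of_calculus)
    fix x
    have "((\<lambda>x. g x * h x) has_real_derivative g x * deriv h x + deriv g x * h x) (at x)"
      using smooth_has_deriv[OF g(1)] smooth_has_deriv[OF h]
      by (auto intro!: derivative_eq_intros)
    then show "((\<lambda>x. g x * h x) has_vector_derivative g x * deriv h x + deriv g x * h x) (at x within {a..b})"
      unfolding has_real_derivative_iff_has_vector_derivative[symmetric]
      by (rule DERIV_subset) simp
  qed (use ab in simp)
  \<comment> \<open>The integrands for \<open>f\<close> and for \<open>g\<close> can differ only at
    \<open>b\<close>.\<close>
  then have int: "((\<lambda>x. f x * deriv h x + right_deriv f x * h x) has_integral g b * h b - g a * h a) {a..b}"
    by (rule has_integral_spike_finite[of "{b}", rotated -1])
      (use g right_deriv_eq[OF g] in auto)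
  have jump: "jump f b = f b - g b"
    using Lim_at_left_eq[OF g ab(1)] by (simp add: jump_def)
  have sum: "(\<Sum>t\<in>T \<inter> {a<..b}. jump f t * h t) = jump f b * h b"
  proof (cases "b \<in> T")
    case True
    then have "T \<inter> {a<..b} = {b}" using ab by fastforce
    then show ?thesis by simp
  next
    case False
    then have "T \<inter> {a<..b} = {}" using ab by (fastforce simp: le_less)
    then show ?thesis using jump_eq_0[OF f False] by simp
  qed
  \<comment> \<open>Replacing \<open>g b\<close> by \<open>f b\<close> in the boundary term costs
    exactly the jump at \<open>b\<close>.\<close>
  have "f b * h b - f a * h a - (\<Sum>t\<in>T \<inter> {a<..b}. jump f t * h t) = g b * h b - g a * h a"
    using g(2)[of a] ab(1) unfolding sum jump by (simp add: algebra_simps)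
  with int show "?P a b"
    by (simp only:)
qed auto

section \<open>Derivatives of piecewise-smooth distributions\<close>

lemma impulsive_jumps:
  assumes "smooth_off T f"
  shows "impulsive (\<lambda>t \<phi>. jump f t * dirac t \<phi>)"
  unfolding impulsive_def
proof
  have "{t. (\<lambda>\<phi>. jump f t * dirac t \<phi>) \<noteq> 0} \<subseteq> T"
    using jump_eq_0[OF assms] by (auto simp: zero_fun_def)
  then show "locally_finite {t. (\<lambda>\<phi>. jump f t * dirac t \<phi>) \<noteq> 0}"
    using assms locally_finite_subset by (auto simp: smooth_off_def)
qed (simp add: dirac_in_span)

text \<open>Integration by parts on an interval \<open>[-B, B]\<close> outside which the test
  function vanishes: the boundary terms are 0 and only the jumps remain.\<close>

lemma ddt_dist_of_fun:
  assumes "smooth_off T f"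
  shows "ddt (dist_of_fun f) \<phi> = dist_of_fun (right_deriv f) \<phi> + (\<Sum>\<^sub>\<infinity>t\<in>UNIV. jump f t * dirac t \<phi>)"
proof -
  obtain R where R: "R > 0" "\<And>x. \<bar>x\<bar> \<ge> R \<Longrightarrow> apply_test \<phi> x = 0"
    using test_fun_support by blast
  obtain R' where R': "R' > 0" "\<And>x. \<bar>x\<bar> \<ge> R' \<Longrightarrow> apply_test (deriv_test \<phi>) x = 0"
    using test_fun_support by blast
  define B where "B = max R R'"
  let ?h = "apply_test \<phi>" and ?F = "\<lambda>x. f x * deriv (apply_test \<phi>) x + right_deriv f x * apply_test \<phi> x"
  have B: "B > 0" "?h x = 0" "deriv ?h x = 0" if "\<bar>x\<bar> \<ge> B" for x
    using that R R' by (auto simp: B_def deriv_test.rep_eq)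
  have "B > 0" using R by (auto simp: B_def)
  have "smooth_off T (right_deriv f)"
    using assms by (rule smooth_off_right_deriv)
  then have pw: "piecewise_smooth f" "piecewise_smooth (right_deriv f)"
    using assms piecewise_smooth_iff by blast+
  have int: "integrable lborel (\<lambda>x. f x * deriv ?h x)" "integrable lborel (\<lambda>x. right_deriv f x * ?h x)"
    using piecewise_smooth_test_integrable[OF pw(1), of "deriv_test \<phi>"]
      piecewise_smooth_test_integrable[OF pw(2), of \<phi>] by (auto simp: deriv_test.rep_eq)
  have sum_eq: "(\<Sum>t\<in>T \<inter> {-B<..B}. jump f t * ?h t) = (\<Sum>\<^sub>\<infinity>t\<in>UNIV. jump f t * dirac t \<phi>)"
  proof -
    have fin: "finite (T \<inter> {-B<..B})"
      using assms by (auto simp: smooth_off_def locally_finite_def intro: finite_subset[of _ "T \<inter> {-B..B}"])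
    have "t \<in> T \<inter> {-B<..B}" if "jump f t * ?h t \<noteq> 0" for t
      using that jump_eq_0[OF assms] B(2)[of t] by force
    then have "(\<Sum>\<^sub>\<infinity>t\<in>UNIV. jump f t * ?h t) = (\<Sum>\<^sub>\<infinity>t\<in>T \<inter> {-B<..B}. jump f t * ?h t)"
      by (intro infsum_cong_neutral) blast+
    then show ?thesis using fin by (simp add: dirac_def)
  qed
  \<comment> \<open>The same integral is evaluated twice: as a Lebesgue integral over the line and
    through integration by parts on \<open>[-B, B]\<close>.\<close>
  have "(?F has_integral (LINT x|lborel. ?F x)) UNIV"
    using int by (intro has_integral_integral_lborel) auto
  moreover have "(?F has_integral - (\<Sum>t\<in>T \<inter> {-B<..B}. jump f t * ?h t)) {-B..B}"
    using smooth_off_integration_by_parts[OF assms smooth_apply_test, of "-B" B \<phi>] B(2)[of B] B(2)[of "-B"] \<open>B > 0\<close>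
    by simp
  then have "(?F has_integral - (\<Sum>t\<in>T \<inter> {-B<..B}. jump f t * ?h t)) UNIV"
    by (rule has_integral_on_superset) (use B in auto)
  ultimately have "(LINT x|lborel. ?F x) = - (\<Sum>t\<in>T \<inter> {-B<..B}. jump f t * ?h t)"
    by (rule has_integral_unique)
  then show ?thesis
    using int sum_eq by (simp add: ddt_def dist_of_fun_def deriv_test.rep_eq)
qed

lemma impulsive_ddt:
  assumes "impulsive P"
  shows "impulsive (\<lambda>t. ddt (P t))"
  unfolding impulsive_def
proof
  have "{t. ddt (P t) \<noteq> 0} \<subseteq> {t. P t \<noteq> 0}"
    by (auto simp: ddt_def fun_eq_iff)
  then show "locally_finite {t. ddt (P t) \<noteq> 0}"
    using assms locally_finite_subset by (auto simp: impulsive_def)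
qed (use assms ddt_dirac_span impulsive_def in auto)

lemma pw_smooth_dist_lincomb:
  "D \<in> pw_smooth_dist \<Longrightarrow> D' \<in> pw_smooth_dist \<Longrightarrow> (\<lambda>\<phi>. a * D \<phi> + b * D' \<phi>) \<in> pw_smooth_dist"
  unfolding pw_smooth_dist_def using pw_decomp_lincomb by blast

lemma pw_smooth_dist_zero: "0 \<in> pw_smooth_dist"
proof -
  have "pw_decomp 0 (\<lambda>_. 0) (\<lambda>_. 0)"
    using smooth_imp_smooth_off[OF smooth_const[of 0]] piecewise_smooth_iff
    by (auto simp: pw_decomp_iff impulsive_def locally_finite_def zero_in_dirac_span dist_of_fun_def)
  then show ?thesis
    unfolding pw_smooth_dist_def by blast
qed

text \<open>Lets restriction act linearly on the derivative in the state equation. Each jump of the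
  function part creates a Dirac impulse; impulses already present are differentiated.\<close>

lemma pw_smooth_dist_ddt:
  assumes "D \<in> pw_smooth_dist"
  shows "ddt D \<in> pw_smooth_dist"
proof -
  obtain f P where f: "piecewise_smooth f" and P: "impulsive P"
    and D: "D = (\<lambda>\<phi>. dist_of_fun f \<phi> + (\<Sum>\<^sub>\<infinity>t\<in>UNIV. P t \<phi>))"
    using assms by (auto simp: pw_smooth_dist_def pw_decomp_iff)
  obtain T where T: "smooth_off T f"
    using f piecewise_smooth_iff by blast
  let ?Q = "\<lambda>t \<phi>. 1 * (jump f t * dirac t \<phi>) + 1 * ddt (P t) \<phi>"
  have "ddt D \<phi> = dist_of_fun (right_deriv f) \<phi> + (\<Sum>\<^sub>\<infinity>t\<in>UNIV. ?Q t \<phi>)" for \<phi>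
  proof -
    have "ddt D \<phi> = ddt (dist_of_fun f) \<phi> + (\<Sum>\<^sub>\<infinity>t\<in>UNIV. ddt (P t) \<phi>)"
      by (simp add: D ddt_def infsum_uminus)
    also have "\<dots> = dist_of_fun (right_deriv f) \<phi> + (\<Sum>\<^sub>\<infinity>t\<in>UNIV. ?Q t \<phi>)"
      unfolding infsum_impulsive_lincomb[OF impulsive_jumps[OF T] impulsive_ddt[OF P]]
      by (simp add: ddt_dist_of_fun[OF T])
    finally show ?thesis .
  qed
  moreover have "impulsive ?Q"
    by (intro impulsive_lincomb impulsive_jumps[OF T] impulsive_ddt P)
  moreover have "piecewise_smooth (right_deriv f)"
    using smooth_off_right_deriv[OF T] piecewise_smooth_iff by blast
  ultimately have "pw_decomp (ddt D) (right_deriv f) ?Q"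
    by (simp add: pw_decomp_iff fun_eq_iff)
  then show ?thesis
    unfolding pw_smooth_dist_def by blast
qed

text \<open>By uniqueness the parts of the combination are the combinations of the parts, after
  which the integral and the sum over \<open>J\<close> are both linear. Measurability of
  \<open>J\<close> keeps the cut-off integrands integrable.\<close>

lemma restrict_dist_lincomb:
  assumes "D \<in> pw_smooth_dist" "D' \<in> pw_smooth_dist" "J \<in> sets borel"
  shows "restrict_dist J (\<lambda>\<phi>. a * D \<phi> + b * D' \<phi>) = (\<lambda>\<phi>. a * restrict_dist J D \<phi> + b * restrict_dist J D' \<phi>)"
proof
  fix \<phi>
  note D = pw_decomp_exists[OF assms(1)] and D' = pw_decomp_exists[OF assms(2)]
  note parts = pw_decomp_parts[OF pw_decomp_lincomb[OF D D', of a b]]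
  have pw: "piecewise_smooth (fun_part D)" "impulsive (impulse D)"
     "piecewise_smooth (fun_part D')" "impulsive (impulse D')"
    using D D' by (auto simp: pw_decomp_iff)
  show "restrict_dist J (\<lambda>\<phi>. a * D \<phi> + b * D' \<phi>) \<phi> = a * restrict_dist J D \<phi> + b * restrict_dist J D' \<phi>"
    unfolding restrict_dist_def parts plus_fun_def dist_of_fun_lincomb_on[OF pw(1,3) assms(3)]
      infsum_impulsive_lincomb[OF pw(2,4)]
    by (simp add: algebra_simps)
qed

text \<open>Applied to mode intervals that miss a block: there the equations reduce to
  \<open>0 = 0\<close>.\<close>

lemma restrict_dist_empty: "restrict_dist {} D = 0"
  by (simp add: restrict_dist_def dist_of_fun_def fun_eq_iff)

section \<open>Solutions and detectability\<close>

lemma dist_diff_eq: "D - D' = (\<lambda>\<phi>. 1 * D \<phi> + (- 1) * D' \<phi>)" for D D' :: dist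
  by (simp add: fun_eq_iff)

lemma pw_smooth_dist_diff: "D \<in> pw_smooth_dist \<Longrightarrow> D' \<in> pw_smooth_dist \<Longrightarrow> D - D' \<in> pw_smooth_dist"
  unfolding dist_diff_eq by (rule pw_smooth_dist_lincomb)

lemma pw_smooth_dist_add: "D \<in> pw_smooth_dist \<Longrightarrow> D' \<in> pw_smooth_dist \<Longrightarrow> D + D' \<in> pw_smooth_dist"
  using pw_smooth_dist_lincomb[of D D' 1 1] by (simp add: plus_fun_def)

lemma pw_smooth_dist_sum:
  assumes "finite A" "\<And>j. j \<in> A \<Longrightarrow> D j \<in> pw_smooth_dist"
  shows "(\<lambda>\<phi>. \<Sum>j\<in>A. c j * D j \<phi>) \<in> pw_smooth_dist"
  using assms
proof (induction A rule: finite_induct)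
  case empty
  then show ?case using pw_smooth_dist_zero by (simp add: zero_fun_def)
next
  case (insert j A)
  then show ?case
    using pw_smooth_dist_lincomb[of "D j" "\<lambda>\<phi>. \<Sum>j\<in>A. c j * D j \<phi>" "c j" 1] by simp
qed

lemma fun_part_diff:
  assumes "D \<in> pw_smooth_dist" "D' \<in> pw_smooth_dist"
  shows "fun_part (D - D') = (\<lambda>t. fun_part D t - fun_part D' t)"
  using pw_decomp_parts(1)[OF pw_decomp_lincomb[OF assms[THEN pw_decomp_exists], of 1 "-1"]]
  by (simp add: dist_diff_eq)

lemma restrict_dist_diff:
  assumes "D \<in> pw_smooth_dist" "D' \<in> pw_smooth_dist" "J \<in> sets borel"
  shows "restrict_dist J (D - D') = restrict_dist J D - restrict_dist J D'"
  unfolding dist_diff_eq by (rule restrict_dist_lincomb) fact+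

section \<open>Vectors of distributions and their one-sided values\<close>

definition pw_smooth_vec :: "dist ^ 'n \<Rightarrow> bool" where
  "pw_smooth_vec x \<longleftrightarrow> (\<forall>i. x $ i \<in> pw_smooth_dist)"

lemma pw_smooth_vec_add: "pw_smooth_vec x \<Longrightarrow> pw_smooth_vec y \<Longrightarrow> pw_smooth_vec (x + y)"
  and pw_smooth_vec_diff: "pw_smooth_vec x \<Longrightarrow> pw_smooth_vec y \<Longrightarrow> pw_smooth_vec (x - y)"
  and pw_smooth_vec_ddt: "pw_smooth_vec x \<Longrightarrow> pw_smooth_vec (ddt_vec x)"
  and pw_smooth_vec_mat: "pw_smooth_vec x \<Longrightarrow> pw_smooth_vec (mat_dist Q x)"
  by (simp_all add: pw_smooth_vec_def pw_smooth_dist_add pw_smooth_dist_diff ddt_vec_def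
      pw_smooth_dist_ddt mat_dist_def pw_smooth_dist_sum)

lemma restrict_vec_diff:
  assumes "pw_smooth_vec x" "pw_smooth_vec y" "J \<in> sets borel"
  shows "restrict_vec J (x - y) = restrict_vec J x - restrict_vec J y"
  using assms by (simp add: vec_eq_iff restrict_vec_def pw_smooth_vec_def restrict_dist_diff)

lemma restrict_vec_empty: "restrict_vec {} x = 0"
  by (simp add: vec_eq_iff restrict_vec_def restrict_dist_empty)

lemma mat_dist_diff: "mat_dist Q (x - y) = mat_dist Q x - mat_dist Q y"
  by (simp add: vec_eq_iff fun_eq_iff mat_dist_def right_diff_distrib sum_subtractf)

lemma mat_dist_zero: "mat_dist Q 0 = 0"
  by (simp add: vec_eq_iff fun_eq_iff mat_dist_def)

lemma ddt_vec_diff: "ddt_vec (x - y) = ddt_vec x - ddt_vec y"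
  by (simp add: vec_eq_iff fun_eq_iff ddt_vec_def ddt_def)

lemma right_val_eq:
  assumes "pw_smooth_vec x"
  shows "right_val x t = (\<chi> i. fun_part (x $ i) t)"
proof -
  have "Lim (at_right t) (fun_part (x $ i)) = fun_part (x $ i) t" for i
    using assms pw_decomp_exists[of "x $ i"]
    by (intro tendsto_Lim piecewise_smooth_at_right) (auto simp: pw_smooth_vec_def pw_decomp_iff)
  then show ?thesis
    by (simp add: right_val_def)
qed

text \<open>Carries an estimate of right values at times before \<open>t\<close> over to
  \<open>left_val x t\<close>. Since function parts are right-continuous, right values are ordinary
  values, and their left limit is the left value.\<close>

lemma left_val_tendsto:
  assumes "pw_smooth_vec x"
  shows "(right_val x \<longlongrightarrow> left_val x t) (at_left t)"
proof (rule vec_tendstoI)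
  fix i
  have "(fun_part (x $ i) \<longlongrightarrow> Lim (at_left t) (fun_part (x $ i))) (at_left t)"
    using assms pw_decomp_exists[of "x $ i"]
    by (intro piecewise_smooth_at_left) (auto simp: pw_smooth_vec_def pw_decomp_iff)
  then show "((\<lambda>s. right_val x s $ i) \<longlongrightarrow> left_val x t $ i) (at_left t)"
    by (simp add: right_val_eq[OF assms] left_val_def)
qed

lemma right_val_diff:
  assumes "pw_smooth_vec x" "pw_smooth_vec y"
  shows "right_val (x - y) t = right_val x t - right_val y t"
  using assms unfolding right_val_eq[OF assms(1)] right_val_eq[OF assms(2)] right_val_eq[OF pw_smooth_vec_diff[OF assms]]
  by (simp add: vec_eq_iff fun_part_diff pw_smooth_vec_def)

lemma left_val_diff:
  assumes "pw_smooth_vec x" "pw_smooth_vec y"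
  shows "left_val (x - y) t = left_val x t - left_val y t"
proof (rule tendsto_unique)
  show "(right_val (x - y) \<longlongrightarrow> left_val (x - y) t) (at_left t)"
    using assms by (intro left_val_tendsto pw_smooth_vec_diff)
  show "(right_val (x - y) \<longlongrightarrow> left_val x t - left_val y t) (at_left t)"
    using tendsto_diff[OF left_val_tendsto[OF assms(1)] left_val_tendsto[OF assms(2)]]
    by (simp flip: right_val_diff[OF assms])
qed simp

section \<open>Differences and restrictions of solutions\<close>

lemma is_solution_pw_smooth: "is_solution S \<sigma> \<tau> I x u y \<Longrightarrow> pw_smooth_vec x"
  by (simp add: is_solution_def pw_smooth_vec_def)

text \<open>The equations are subtracted on each mode interval, where input and output cancel.
  Piecewise smoothness of all vectors and measurability of the interval make restriction
  linear.\<close>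

lemma is_solution_diff:
  assumes "is_solution S \<sigma> \<tau> I x1 u y" "is_solution S \<sigma> \<tau> I x2 u y" "I \<in> sets borel"
  shows "is_solution S \<sigma> \<tau> I (x1 - x2) 0 0"
proof -
  have pw: "pw_smooth_vec x1" "pw_smooth_vec x2" "pw_smooth_vec u" "pw_smooth_vec y"
    using assms by (auto simp: is_solution_def pw_smooth_vec_def)
  have "restrict_vec J (mat_dist (Emat S m) (ddt_vec (x1 - x2)))
          = restrict_vec J (mat_dist (Amat S m) (x1 - x2) + mat_dist (Bmat S m) 0)"
    "restrict_vec J 0 = restrict_vec J (mat_dist (Cmat S m) (x1 - x2) + mat_dist (Dmat S m) 0)"
    if J: "J = I \<inter> {\<tau> k..<\<tau> (Suc k)}" and m: "m = \<sigma> (\<tau> k)" for k J m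
  proof -
    have borel: "J \<in> sets borel" using J assms(3) by auto
    note sol = assms(1,2)[unfolded is_solution_def Let_def, THEN conjunct2, THEN conjunct2, THEN conjunct2,
        rule_format, of k, folded J m]
    note rules = pw pw_smooth_vec_mat pw_smooth_vec_ddt pw_smooth_vec_add borel
    have "restrict_vec J (mat_dist (Emat S m) (ddt_vec (x1 - x2)))
        = restrict_vec J (mat_dist (Emat S m) (ddt_vec x1)) - restrict_vec J (mat_dist (Emat S m) (ddt_vec x2))"
      unfolding ddt_vec_diff mat_dist_diff by (intro restrict_vec_diff rules)
    also have "\<dots> = restrict_vec J (mat_dist (Amat S m) x1 + mat_dist (Bmat S m) u)
        - restrict_vec J (mat_dist (Amat S m) x2 + mat_dist (Bmat S m) u)"
      using sol by simp
    also have "\<dots> = restrict_vec J ((mat_dist (Amat S m) x1 + mat_dist (Bmat S m) u)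
        - (mat_dist (Amat S m) x2 + mat_dist (Bmat S m) u))"
      by (intro restrict_vec_diff[symmetric] rules)
    finally show "restrict_vec J (mat_dist (Emat S m) (ddt_vec (x1 - x2)))
          = restrict_vec J (mat_dist (Amat S m) (x1 - x2) + mat_dist (Bmat S m) 0)"
      by (simp add: mat_dist_diff mat_dist_zero)
    \<comment> \<open>The zero output is written as \<open>y - y\<close>, so that the two output
      equations can be subtracted like the state equations.\<close>
    have "restrict_vec J 0 = restrict_vec J (y - y)" by simp
    also have "\<dots> = restrict_vec J y - restrict_vec J y"
      by (intro restrict_vec_diff rules)
    also have "\<dots> = restrict_vec J (mat_dist (Cmat S m) x1 + mat_dist (Dmat S m) u)
        - restrict_vec J (mat_dist (Cmat S m) x2 + mat_dist (Dmat S m) u)"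
      using sol by metis
    also have "\<dots> = restrict_vec J ((mat_dist (Cmat S m) x1 + mat_dist (Dmat S m) u)
        - (mat_dist (Cmat S m) x2 + mat_dist (Dmat S m) u))"
      by (intro restrict_vec_diff[symmetric] rules)
    finally show "restrict_vec J 0 = restrict_vec J (mat_dist (Cmat S m) (x1 - x2) + mat_dist (Dmat S m) 0)"
      by (simp add: mat_dist_diff mat_dist_zero)
  qed
  moreover have "pw_smooth_vec (x1 - x2)"
    using pw by (intro pw_smooth_vec_diff)
  ultimately show ?thesis
    by (simp add: is_solution_def Let_def pw_smooth_vec_def pw_smooth_dist_zero)
qed

text \<open>The ends of the block are switching times, so each mode interval lies entirely inside or
  entirely outside. Inside, the equations are those on \<open>{0..}\<close>; outside, both sides are
  restricted to the empty set.\<close>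

lemma is_solution_interval:
  assumes "strict_mono \<tau>" "\<tau> 0 = 0" "is_solution S \<sigma> \<tau> {0..} x u y"
  shows "is_solution S \<sigma> \<tau> {\<tau> a..<\<tau> b} x u y"
proof -
  have "{\<tau> a..<\<tau> b} \<inter> {\<tau> k..<\<tau> (Suc k)} = (if a \<le> k \<and> k < b then {0..} \<inter> {\<tau> k..<\<tau> (Suc k)} else {})" for k
  proof -
    have "\<tau> k \<ge> 0" using assms(1,2) by (metis strict_mono_less_eq zero_le)
    moreover have "\<tau> a \<le> \<tau> k \<longleftrightarrow> a \<le> k" "\<tau> (Suc k) \<le> \<tau> b \<longleftrightarrow> k < b" "\<tau> (Suc k) \<le> \<tau> a \<longleftrightarrow> k < a" "\<tau> b \<le> \<tau> k \<longleftrightarrow> b \<le> k"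
      using assms(1) by (auto simp: strict_mono_less_eq)
    ultimately show ?thesis by (auto simp: not_le not_less)
  qed
  then show ?thesis
    using assms(3) by (simp add: is_solution_def Let_def restrict_vec_empty del: Int_atLeastLessThan)
qed

section \<open>Estimates on one block\<close>

lemma interval_contraction:
  assumes det: "interval_detectable S \<sigma> \<tau> a b \<beta>"
    and sol: "is_solution S \<sigma> \<tau> {\<tau> a..<\<tau> b} x 0 0"
    and "\<tau> a < \<tau> b"
    and contr: "\<And>r. r > 0 \<Longrightarrow> \<beta> r (\<tau> b - \<tau> a) \<le> \<alpha> * r"
    and left_cont: "\<And>r. r > 0 \<Longrightarrow> continuous (at_left (\<tau> b - \<tau> a)) (\<beta> r)"
  shows "norm (left_val x (\<tau> b)) \<le> \<alpha> * norm (left_val x (\<tau> a))"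
proof -
  define r where "r = norm (left_val x (\<tau> a))"
  have le: "norm (right_val x t) \<le> \<beta> r (t - \<tau> a)" if "t \<in> {\<tau> a..<\<tau> b}" for t
    using det sol that unfolding interval_detectable_def r_def by blast
  \<comment> \<open>The estimate stops short of \<open>\<tau> b\<close>, so both of its sides are
    followed to their left limits there.\<close>
  have "((\<lambda>t. norm (right_val x t)) \<longlongrightarrow> norm (left_val x (\<tau> b))) (at_left (\<tau> b))"
    by (intro tendsto_norm left_val_tendsto is_solution_pw_smooth[OF sol])
  moreover have "((\<lambda>t. \<beta> r (t - \<tau> a)) \<longlongrightarrow> \<beta> r (\<tau> b - \<tau> a)) (at_left (\<tau> b))"
  \<comment> \<open>Left-continuity is assumed for positive \<open>r\<close> only; for
    \<open>r = 0\<close> the bound is constantly 0 by the class KL property.\<close>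
  proof (cases "r = 0")
    case True
    have "\<beta> 0 s = 0" if "s \<ge> 0" for s
      using det that unfolding interval_detectable_def class_KL_def by blast
    moreover have "eventually (\<lambda>t. t > \<tau> a) (at_left (\<tau> b))"
      using \<open>\<tau> a < \<tau> b\<close> by (auto simp: eventually_at_left_field intro!: exI[of _ "\<tau> a"])
    ultimately show ?thesis
      using True \<open>\<tau> a < \<tau> b\<close> by (intro tendsto_eventually) (auto elim: eventually_mono)
  next
    case False
    then have "(\<beta> r \<longlongrightarrow> \<beta> r (\<tau> b - \<tau> a)) (at_left (\<tau> b - \<tau> a))"
      using left_cont[of r] by (simp add: r_def continuous_within)
    moreover have "filterlim (\<lambda>t. t - \<tau> a) (at_left (\<tau> b - \<tau> a)) (at_left (\<tau> b))"
      by (auto simp: filterlim_at eventually_at_filter intro!: tendsto_intros)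
    ultimately show ?thesis
      by (rule filterlim_compose)
  qed
  moreover have "eventually (\<lambda>t. norm (right_val x t) \<le> \<beta> r (t - \<tau> a)) (at_left (\<tau> b))"
    using \<open>\<tau> a < \<tau> b\<close> le by (auto simp: eventually_at_left_field intro!: exI[of _ "\<tau> a"])
  ultimately have "norm (left_val x (\<tau> b)) \<le> \<beta> r (\<tau> b - \<tau> a)"
    by (intro tendsto_le[rotated]) auto
  also have "\<dots> \<le> \<alpha> * r"
  proof (cases "r = 0")
    case True
    then show ?thesis
      using det \<open>\<tau> a < \<tau> b\<close> unfolding interval_detectable_def class_KL_def by auto
  next
    case False
    then show ?thesis using contr[of r] by (simp add: r_def)
  qed
  finally show ?thesis by (simp add: r_def)
qed

text \<open>Since \<open>\<beta> r\<close> decreases in time, its value at time 0 bounds the whole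
  block.\<close>

lemma interval_bound:
  assumes det: "interval_detectable S \<sigma> \<tau> a b \<beta>"
    and sol: "is_solution S \<sigma> \<tau> {\<tau> a..<\<tau> b} x 0 0"
    and t: "t \<in> {\<tau> a..<\<tau> b}"
    and bound: "\<And>r. r > 0 \<Longrightarrow> \<beta> r 0 \<le> M * r"
  shows "norm (right_val x t) \<le> M * norm (left_val x (\<tau> a))"
proof -
  define r where "r = norm (left_val x (\<tau> a))"
  have "r \<ge> 0" by (simp add: r_def)
  have KL: "class_KL \<beta>" using det by (simp add: interval_detectable_def)
  have "norm (right_val x t) \<le> \<beta> r (t - \<tau> a)"
    using det sol t unfolding interval_detectable_def r_def by blast
  also have "\<dots> \<le> \<beta> r 0"
    using KL \<open>r \<ge> 0\<close> t unfolding class_KL_def by (auto simp: monotone_on_def)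
  also have "\<dots> \<le> M * r"
    using KL bound[of r] \<open>r \<ge> 0\<close> unfolding class_KL_def by (cases "r = 0") auto
  finally show ?thesis by (simp add: r_def)
qed

text \<open>In the application \<open>N\<close> counts completed blocks, so the bound is a step
  function of time, which \<open>class_KL\<close> permits. Strict growth in \<open>r\<close> comes
  from \<open>\<alpha> ^ N t > 0\<close>, decrease in \<open>t\<close> from monotonicity of
  \<open>N\<close>, and the limit 0 from its divergence.\<close>

lemma class_KL_geometric:
  assumes "0 < \<alpha>" "\<alpha> < 1" "M > 0" "mono N" "filterlim N at_top (at_top :: real filter)"
  shows "class_KL (\<lambda>r t. M * r * \<alpha> ^ N t)"
proof -
  have "antimono_on {0..} (\<lambda>t. M * r * \<alpha> ^ N t)" if "r \<ge> 0" for r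
    using assms that
    by (auto simp: monotone_on_def intro!: mult_left_mono power_decreasing dest: monoD)
  moreover have "((\<lambda>t. M * r * \<alpha> ^ N t) \<longlongrightarrow> 0) at_top" for r
  proof -
    have "((\<lambda>t. \<alpha> ^ N t) \<longlongrightarrow> 0) at_top"
      using assms by (intro filterlim_compose[OF LIMSEQ_power_zero]) auto
    then show ?thesis by (rule tendsto_mult_right_zero)
  qed
  moreover have "strict_mono_on {0..} (\<lambda>r. M * r * \<alpha> ^ N t)" for t
    using assms by (auto simp: monotone_on_def)
  ultimately show ?thesis
    using assms unfolding class_KL_def by (auto intro!: continuous_intros)
qed

section \<open>Iteration over the blocks\<close>

theorem proposition8:
  fixes S :: "('n :: finite, 'u :: finite, 'y :: finite) switched_dae"
    and \<sigma> :: "real \<Rightarrow> nat" and \<tau> :: "nat \<Rightarrow> real"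
    and p q :: "nat \<Rightarrow> nat" and \<alpha> M :: real and \<beta> :: "nat \<Rightarrow> real \<Rightarrow> real \<Rightarrow> real"
  assumes switching: "switching_signal \<sigma> \<tau>"
    and q: "strict_mono q" "q 0 > 0"
    and p: "p 0 = 0" "\<And>i. p (Suc i) = q i"
    and \<alpha>: "0 < \<alpha>" "\<alpha> < 1" and M: "M \<ge> 1"
    and interval_det: "\<And>i. interval_detectable S \<sigma> \<tau> (p i) (q i) (\<beta> i)"
    and contraction: "\<And>i r. r > 0 \<Longrightarrow> \<beta> i r (\<tau> (q i) - \<tau> (p i)) \<le> \<alpha> * r"
    and bound: "\<And>i r. r > 0 \<Longrightarrow> \<beta> i r 0 \<le> M * r"
    and left_cont: "\<And>i r. r > 0 \<Longrightarrow> continuous (at_left (\<tau> (q i) - \<tau> (p i))) (\<beta> i r)"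
  shows "detectable S \<sigma> \<tau>"
proof -
  have \<tau>: "strict_mono \<tau>" "\<tau> 0 = 0" and fin: "finite {k. \<tau> k \<le> b}" for b
    using switching by (auto simp: switching_signal_def)
  have pq: "\<tau> (p i) < \<tau> (q i)" for i
    using q p \<tau>(1) by (cases i) (auto simp: strict_mono_less)
  have unbounded: "\<exists>i. t < \<tau> (q i)" for t
  proof -
    \<comment> \<open>Only finitely many switching times lie at or before \<open>t\<close>, and
      \<open>k \<le> q k\<close> passes from switching times to block ends.\<close>
    obtain k where "k \<notin> {k. \<tau> k \<le> t}"
      using fin[of t] by (metis ex_new_if_finite infinite_UNIV_nat)
    moreover have "\<tau> k \<le> \<tau> (q k)"
      using q(1) \<tau>(1) by (simp add: strict_mono_imp_increasing strict_mono_less_eq)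
    ultimately show ?thesis by (auto intro!: exI[of _ k])
  qed
  \<comment> \<open>For \<open>t \<ge> 0\<close> this is the index of the block containing
    \<open>t\<close>: by minimality every earlier block has ended by time \<open>t\<close>.\<close>
  define N where "N t = (LEAST i. t < \<tau> (q i))" for t
  have N_upper: "t < \<tau> (q (N t))" for t
    unfolding N_def using unbounded by (rule LeastI_ex)
  have N_lower: "\<tau> (p (N t)) \<le> t" if "t \<ge> 0" for t
  proof (cases "N t")
    case 0
    then show ?thesis using that p \<tau> by simp
  next
    case (Suc j)
    then have "\<not> t < \<tau> (q j)"
      using not_less_Least[of j "\<lambda>i. t < \<tau> (q i)"] by (simp add: N_def)
    then show ?thesis using Suc p by simp
  qed
  have "mono N"
  proof
    fix s t :: real assume "s \<le> t"
    then show "N s \<le> N t"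
      unfolding N_def[of s] using N_upper[of t] by (intro Least_le) simp
  qed
  have "filterlim N at_top at_top"
    unfolding filterlim_at_top
  proof
    fix k
    have "k \<le> N t" if "t \<ge> \<tau> (q k)" for t
    proof -
      have "\<tau> (q k) < \<tau> (q (N t))"
        using that N_upper[of t] by linarith
      then show ?thesis
        using q(1) \<tau>(1) by (simp add: strict_mono_less)
    qed
    then show "eventually (\<lambda>t. k \<le> N t) at_top"
      unfolding eventually_at_top_linorder by blast
  qed
  have decay: "norm (right_val x t) \<le> M * norm (left_val x 0) * \<alpha> ^ N t"
    if sol: "is_solution S \<sigma> \<tau> {0..} x 0 0" and t: "t \<ge> 0" for x t
  proof -
    note sol = is_solution_interval[OF \<tau> sol]
    \<comment> \<open>The left limit at the end of a block is the initial left value of the next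
      one, so the contraction can be iterated.\<close>
    have left: "norm (left_val x (\<tau> (p i))) \<le> \<alpha> ^ i * norm (left_val x 0)" for i
    proof (induction i)
      case 0
      then show ?case by (simp add: p \<tau>)
    next
      case (Suc i)
      have "norm (left_val x (\<tau> (p (Suc i)))) \<le> \<alpha> * norm (left_val x (\<tau> (p i)))"
        unfolding p(2) by (rule interval_contraction[OF interval_det sol pq contraction left_cont])
      also have "\<dots> \<le> \<alpha> * (\<alpha> ^ i * norm (left_val x 0))"
        using Suc \<alpha> by (intro mult_left_mono) auto
      finally show ?case by (simp add: mult.assoc)
    qed
    \<comment> \<open>The \<open>N t\<close> complete blocks before \<open>t\<close> contribute a
      factor \<open>\<alpha>\<close> each; the current block contributes the factor
      \<open>M\<close>.\<close>
    have "norm (right_val x t) \<le> M * norm (left_val x (\<tau> (p (N t))))"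
      using N_lower[OF t] N_upper[of t] by (intro interval_bound[OF interval_det sol _ bound]) auto
    also have "\<dots> \<le> M * (\<alpha> ^ N t * norm (left_val x 0))"
      using left M by (intro mult_left_mono) auto
    finally show ?thesis by (simp add: algebra_simps)
  qed
  have "norm (right_val x1 t - right_val x2 t) \<le> M * norm (left_val x1 0 - left_val x2 0) * \<alpha> ^ N t"
    if sol: "is_solution S \<sigma> \<tau> {0..} x1 u y" "is_solution S \<sigma> \<tau> {0..} x2 u y" and t: "t \<ge> 0" for x1 x2 u y t
    using decay[OF is_solution_diff[OF sol] t] is_solution_pw_smooth[OF sol(1)] is_solution_pw_smooth[OF sol(2)]
    by (simp add: right_val_diff left_val_diff)
  moreover have "class_KL (\<lambda>r t. M * r * \<alpha> ^ N t)"
    using \<alpha> M \<open>mono N\<close> \<open>filterlim N at_top at_top\<close> by (intro class_KL_geometric) auto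
  ultimately show ?thesis
    unfolding detectable_def by blast
qed

end
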